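(* There is a polynomial-time algorithm that, given a weighted house allocation instance $\langle N,H,V\rangle$, computes an allocation that minimizes the total envy among all allocations that maximize the utilitarian welfare $\mathrm{USW}$.
   Context: A house allocation instance $\langle N,H,V\rangle$ consists of a finite set $N$ of $n$ agents, a finite set $H$ of $m$ houses, and for each agent $i\in N$ a valuation $v_i:H\to\mathbb{R}_{\ge 0}$, with the convention $v_i(\emptyset)=0$. A weighted instance allows arbitrary non-negative values. An allocation $A$ assigns to each agent $i$ either one house $A(i)\in H$ or nothing ($A(i)=\emptyset$), with each house assigned to at most one agent; an agent may be assigned a house it values at zero, and houses may remain unassigned. The total envy of $A$ is $\sum_{i\in N}\sum_{j\in N}\max\{v_i(A(j))-v_i(A(i)),0\}$. The utilitarian welfare is $\mathrm{USW}(A)=\sum_{i\in N}v_i(A(i))$. *)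

theory Defs
  imports Complex_Main "HOL-Computational_Algebra.Polynomial"
begin

section \<open>House allocation\<close>

definition house_instance :: "'a set \<Rightarrow> 'h set \<Rightarrow> ('a \<Rightarrow> 'h \<Rightarrow> real) \<Rightarrow> bool" where
  "house_instance N H v \<longleftrightarrow> finite N \<and> finite H \<and> (\<forall>i\<in>N. \<forall>h\<in>H. 0 \<le> v i h)"

definition allocation :: "'a set \<Rightarrow> 'h set \<Rightarrow> ('a \<rightharpoonup> 'h) \<Rightarrow> bool" where
  "allocation N H A \<longleftrightarrow> dom A \<subseteq> N \<and> ran A \<subseteq> H \<and> inj_on A (dom A)"

text \<open>\<open>None\<close> plays the role of the empty bundle.\<close>

fun bundle_value :: "('h \<Rightarrow> real) \<Rightarrow> 'h option \<Rightarrow> real" where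
  "bundle_value u None = 0"
| "bundle_value u (Some h) = u h"

definition total_envy :: "'a set \<Rightarrow> ('a \<Rightarrow> 'h \<Rightarrow> real) \<Rightarrow> ('a \<rightharpoonup> 'h) \<Rightarrow> real" where
  "total_envy N v A =
     (\<Sum>i\<in>N. \<Sum>j\<in>N. max (bundle_value (v i) (A j) - bundle_value (v i) (A i)) 0)"

definition usw :: "'a set \<Rightarrow> ('a \<Rightarrow> 'h \<Rightarrow> real) \<Rightarrow> ('a \<rightharpoonup> 'h) \<Rightarrow> real" where
  "usw N v A = (\<Sum>i\<in>N. bundle_value (v i) (A i))"


section \<open>Model of computation\<close>

text \<open>
  Since valuations are arbitrary reals, programs run on a random access machine over the reals,
  presented as a while language. Memory consists of named two-dimensional arrays of natural
  numbers and of reals, and array accesses may be nested, which gives indirect addressing. Reals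
  can only be added, subtracted and compared; there are no real constants other than integers, no
  rounding, and no conversion between reals and naturals.

  Every assignment, skip and evaluated test costs one unit of time. As expressions are part
  of the program, their evaluation takes boundedly many elementary operations. Multiplication is
  left out on purpose: with it, unit cost would be misleading, as repeated squaring produces
  numbers of exponential length. Without it, \<open>t\<close> steps lengthen the numbers in memory by
  \<open>O(t)\<close> bits only (lemma \<open>exec_magnitudes\<close> below), so that on rational inputs a polynomial
  bound on the number of steps also is a polynomial bound on the bit complexity.
\<close>

type_synonym name = string

datatype nexp =
    NConst nat
  | NLoad name nexp nexp
  | NAdd nexp nexp
  | NSub nexp nexp

datatype rexp =
    RConst int
  | RLoad name nexp nexp
  | RAdd rexp rexp
  | RSub rexp rexp

datatype bexp =
    NLess nexp nexp
  | RLess rexp rexp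
  | Neg bexp
  | Conj bexp bexp

datatype com =
    Skip
  | NStore name nexp nexp nexp
  | RStore name nexp nexp rexp
  | Seq com com
  | If bexp com com
  | While bexp com

record state =
  nmem :: "name \<Rightarrow> nat \<Rightarrow> nat \<Rightarrow> nat"
  rmem :: "name \<Rightarrow> nat \<Rightarrow> nat \<Rightarrow> real"

primrec nval :: "nexp \<Rightarrow> state \<Rightarrow> nat" where
  "nval (NConst k) s = k"
| "nval (NLoad x a b) s = nmem s x (nval a s) (nval b s)"
| "nval (NAdd a b) s = nval a s + nval b s"
| "nval (NSub a b) s = nval a s - nval b s"

primrec rval :: "rexp \<Rightarrow> state \<Rightarrow> real" where
  "rval (RConst k) s = of_int k"
| "rval (RLoad x a b) s = rmem s x (nval a s) (nval b s)"
| "rval (RAdd a b) s = rval a s + rval b s"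
| "rval (RSub a b) s = rval a s - rval b s"

primrec bval :: "bexp \<Rightarrow> state \<Rightarrow> bool" where
  "bval (NLess a b) s \<longleftrightarrow> nval a s < nval b s"
| "bval (RLess a b) s \<longleftrightarrow> rval a s < rval b s"
| "bval (Neg b) s \<longleftrightarrow> \<not> bval b s"
| "bval (Conj a b) s \<longleftrightarrow> bval a s \<and> bval b s"

definition upd :: "(name \<Rightarrow> nat \<Rightarrow> nat \<Rightarrow> 'v) \<Rightarrow> name \<Rightarrow> nat \<Rightarrow> nat \<Rightarrow> 'v \<Rightarrow> name \<Rightarrow> nat \<Rightarrow> nat \<Rightarrow> 'v" where
  "upd f x i j y = f(x := (f x)(i := (f x i)(j := y)))"

text \<open>\<open>exec c s t s'\<close>: started in state \<open>s\<close>, program \<open>c\<close> halts after \<open>t\<close> steps in state \<open>s'\<close>.\<close>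

inductive exec :: "com \<Rightarrow> state \<Rightarrow> nat \<Rightarrow> state \<Rightarrow> bool" where
  Skip: "exec Skip s 1 s"
| NStore: "exec (NStore x a b e) s 1
    (s\<lparr>nmem := upd (nmem s) x (nval a s) (nval b s) (nval e s)\<rparr>)"
| RStore: "exec (RStore x a b e) s 1
    (s\<lparr>rmem := upd (rmem s) x (nval a s) (nval b s) (rval e s)\<rparr>)"
| Seq: "exec c s t s' \<Longrightarrow> exec d s' u s'' \<Longrightarrow> exec (Seq c d) s (t + u) s''"
| IfTrue: "bval b s \<Longrightarrow> exec c s t s' \<Longrightarrow> exec (If b c d) s (Suc t) s'"
| IfFalse: "\<not> bval b s \<Longrightarrow> exec d s t s' \<Longrightarrow> exec (If b c d) s (Suc t) s'"
| WhileFalse: "\<not> bval b s \<Longrightarrow> exec (While b c) s 1 s"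
| WhileTrue: "bval b s \<Longrightarrow> exec c s t s' \<Longrightarrow> exec (While b c) s' u s'' \<Longrightarrow>
    exec (While b c) s (Suc (t + u)) s''"

inductive_cases exec_elims:
  "exec Skip s t s'" "exec (NStore x a b e) s t s'" "exec (RStore x a b e) s t s'"
  "exec (Seq c d) s t s'" "exec (If b c d) s t s'" "exec (While b c) s t s'"

lemma exec_deterministic:
  "exec c s t s' \<Longrightarrow> exec c s u s'' \<Longrightarrow> u = t \<and> s'' = s'"
proof (induction arbitrary: u s'' rule: exec.induct)
  case (Seq c s t s' d t' s3)
  from Seq.prems show ?case by (rule exec_elims) (use Seq.IH in blast)
next
  case (IfTrue b s c t s' d)
  from IfTrue.prems show ?case by (rule exec_elims) (use IfTrue.hyps IfTrue.IH in blast)+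
next
  case (IfFalse b s d t s' c)
  from IfFalse.prems show ?case by (rule exec_elims) (use IfFalse.hyps IfFalse.IH in blast)+
next
  case (WhileFalse b s c)
  from WhileFalse.prems show ?case by (rule exec_elims) (use WhileFalse.hyps in simp_all)
next
  case (WhileTrue b s c t s' t' s3)
  from WhileTrue.prems show ?case
  proof (rule exec_elims)
    fix v w s4
    assume "u = Suc (v + w)" "exec c s v s4" "exec (While b c) s4 w s''"
    then show ?thesis using WhileTrue.IH by blast
  qed (use WhileTrue.hyps in simp)
qed (erule exec_elims, simp)+

text \<open>
  The bound on the growth of numbers: they stay within a factor that is exponential in the number
  of steps, and a common denominator \<open>D\<close> of the reals in the initial memory remains one.
\<close>

primrec nweight :: "nexp \<Rightarrow> nat" where
  "nweight (NConst k) = k"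
| "nweight (NLoad x a b) = 1"
| "nweight (NAdd a b) = nweight a + nweight b"
| "nweight (NSub a b) = nweight a + nweight b"

primrec rweight :: "rexp \<Rightarrow> nat" where
  "rweight (RConst k) = nat \<bar>k\<bar>"
| "rweight (RLoad x a b) = 1"
| "rweight (RAdd a b) = rweight a + rweight b"
| "rweight (RSub a b) = rweight a + rweight b"

primrec weight :: "com \<Rightarrow> nat" where
  "weight Skip = 1"
| "weight (NStore x a b e) = 1 + nweight e"
| "weight (RStore x a b e) = 1 + rweight e"
| "weight (Seq c d) = weight c + weight d"
| "weight (If b c d) = weight c + weight d"
| "weight (While b c) = weight c"

definition magnitudes :: "int \<Rightarrow> real \<Rightarrow> state \<Rightarrow> bool" where
  "magnitudes D B s \<longleftrightarrow> 1 \<le> B \<and>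
     (\<forall>x i j. real (nmem s x i j) \<le> B \<and> \<bar>rmem s x i j\<bar> \<le> B \<and> of_int D * rmem s x i j \<in> \<int>)"

lemma magnitudes_ge_1: "magnitudes D B s \<Longrightarrow> 1 \<le> B"
  by (simp add: magnitudes_def)

lemma magnitudes_nmem: "magnitudes D B s \<Longrightarrow> real (nmem s x i j) \<le> B"
  by (simp add: magnitudes_def)

lemma magnitudes_rmem:
  "magnitudes D B s \<Longrightarrow> \<bar>rmem s x i j\<bar> \<le> B \<and> of_int D * rmem s x i j \<in> \<int>"
  by (simp add: magnitudes_def)

lemma magnitudes_mono: "magnitudes D B s \<Longrightarrow> B \<le> C \<Longrightarrow> magnitudes D C s"
  unfolding magnitudes_def by (meson order_trans)

lemma magnitudes_times:
  assumes "magnitudes D B s" "1 \<le> K"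
  shows "magnitudes D (B * K) s"
  using mult_left_mono[OF assms(2), of B] magnitudes_ge_1[OF assms(1)]
  by (intro magnitudes_mono[OF assms(1)]) simp

lemma nval_le:
  assumes "magnitudes D B s"
  shows "real (nval e s) \<le> real (nweight e) * B"
proof (induction e)
  case (NConst k)
  have "real k * 1 \<le> real k * B"
    using magnitudes_ge_1[OF assms] by (intro mult_left_mono) simp_all
  then show ?case by simp
next
  case (NLoad x a b)
  show ?case using magnitudes_nmem[OF assms] by simp
next
  case (NAdd a b)
  then show ?case by (simp add: distrib_right)
next
  case (NSub a b)
  have "real (nval a s - nval b s) \<le> real (nval a s) + real (nval b s)" by simp
  then show ?case using NSub by (simp add: distrib_right)
qed

lemma rval_le:
  assumes "magnitudes D B s"
  shows "\<bar>rval e s\<bar> \<le> real (rweight e) * B \<and> of_int D * rval e s \<in> \<int>"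
proof (induction e)
  case (RConst k)
  have "\<bar>real_of_int k\<bar> * 1 \<le> \<bar>real_of_int k\<bar> * B"
    using magnitudes_ge_1[OF assms] by (intro mult_left_mono) simp_all
  then show ?case by simp
next
  case (RLoad x a b)
  show ?case using magnitudes_rmem[OF assms] by simp
next
  case (RAdd a b)
  then show ?case
    using abs_triangle_ineq[of "rval a s" "rval b s"] by (simp add: distrib_right distrib_left)
next
  case (RSub a b)
  then show ?case
    using abs_triangle_ineq4[of "rval a s" "rval b s"]
    by (simp add: distrib_right right_diff_distrib)
qed

lemma exec_magnitudes:
  "exec c s t s' \<Longrightarrow> magnitudes D B s \<Longrightarrow> weight c \<le> K \<Longrightarrow> 1 \<le> K \<Longrightarrow>
    magnitudes D (B * real K ^ t) s'"
proof (induction arbitrary: B rule: exec.induct)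
  case (Skip s)
  then show ?case using magnitudes_times[of D B s "real K"] by simp
next
  case (NStore x a b e s)
  have m: "magnitudes D (B * K) s" using NStore by (intro magnitudes_times) simp_all
  have "real (nval e s) \<le> real (nweight e) * B" by (rule nval_le) fact
  also have "\<dots> \<le> real K * B"
    using NStore magnitudes_ge_1[OF NStore.prems(1)] by (intro mult_right_mono) simp_all
  finally show ?case using m by (simp add: magnitudes_def upd_def mult.commute)
next
  case (RStore x a b e s)
  have m: "magnitudes D (B * K) s" using RStore by (intro magnitudes_times) simp_all
  have r: "\<bar>rval e s\<bar> \<le> real (rweight e) * B \<and> of_int D * rval e s \<in> \<int>" by (rule rval_le) fact
  have "real (rweight e) * B \<le> real K * B"
    using RStore magnitudes_ge_1[OF RStore.prems(1)] by (intro mult_right_mono) simp_all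
  then have "\<bar>rval e s\<bar> \<le> B * K" using r by (simp add: mult.commute)
  then show ?case using m r by (simp add: magnitudes_def upd_def)
next
  case (Seq c s t s' d u s'')
  have "magnitudes D (B * K ^ t * K ^ u) s''" using Seq by simp
  then show ?case by (simp add: power_add mult.assoc)
next
  case (IfTrue b s c t s' d)
  have "magnitudes D (B * K ^ t) s'" using IfTrue by simp
  from magnitudes_times[OF this, of K] show ?case using IfTrue.prems(3) by (simp add: ac_simps)
next
  case (IfFalse b s d t s' c)
  have "magnitudes D (B * K ^ t) s'" using IfFalse by simp
  from magnitudes_times[OF this, of K] show ?case using IfFalse.prems(3) by (simp add: ac_simps)
next
  case (WhileFalse b s c)
  then show ?case using magnitudes_times[of D B s "real K"] by simp
next
  case (WhileTrue b s c t s' u s'')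
  have "magnitudes D (B * K ^ t * K ^ u) s''" using WhileTrue by simp
  from magnitudes_times[OF this, of K] show ?case
    using WhileTrue.prems(3) by (simp add: power_add ac_simps)
qed


section \<open>Input and output\<close>

text \<open>
  Agents and houses are numbered \<open>0, \<dots>, n - 1\<close> and \<open>0, \<dots>, m - 1\<close>. All memory cells that do not
  hold the input are zero. In the output array, \<open>0\<close> stands for "no house" and \<open>h + 1\<close> for
  house \<open>h\<close>; nothing forces an output below \<open>m + 1\<close>, that is left to \<open>allocation\<close>.
\<close>

definition input_state :: "nat \<Rightarrow> nat \<Rightarrow> (nat \<Rightarrow> nat \<Rightarrow> real) \<Rightarrow> state" where
  "input_state n m v =
     \<lparr>nmem = upd (upd (\<lambda>_ _ _. 0) ''n'' 0 0 n) ''m'' 0 0 m,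
      rmem = (\<lambda>x i h. if x = ''v'' \<and> i < n \<and> h < m then v i h else 0)\<rparr>"

definition output_allocation :: "nat \<Rightarrow> state \<Rightarrow> (nat \<rightharpoonup> nat)" where
  "output_allocation n s i =
     (if i < n then case nmem s ''out'' i 0 of 0 \<Rightarrow> None | Suc h \<Rightarrow> Some h else None)"

end

(*
In an allocation of maximum welfare nobody prefers an unassigned house, since moving there would
raise the welfare. The total envy of such an allocation is therefore a sum over the agents i of
the terms c_i(x) = sum over all houses h of max(v_i(h) - x, 0), where x is the value of the bundle
of i, and so a maximum-welfare allocation of least envy is a minimum-cost assignment for the
costs (sum_h v_i(h) - x, c_i(x)) in the group R x R, ordered lexicographically. The Hungarian
algorithm solves this assignment problem using only additions, subtractions and comparisons.
*)
theory Submission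
  imports Defs "HOL-Library.Product_Lexorder" "HOL-Library.Product_Plus"
begin

text \<open>Why pairs: a single real cost would need a weight so large that no gain in envy
  outweighs a loss in welfare, but real valuations give no a priori bound on the gaps between
  welfare values, and the machine cannot multiply. The Hungarian method survives the change of group
  because its duality argument only adds and compares, and because its running time is
  combinatorial: a search step adds a column to the tree, an augmentation step lowers a rank,
  whatever the size of the numbers. With \<open>n\<close> dummy columns besides the \<open>m\<close>
  houses, every allocation extends to an injection of the agents into the \<open>K = n + m\<close>
  columns. All loop measures are at most \<open>K + 1\<close>, which the allowance
  \<open>N + 2\<close> with \<open>N = K\<close> covers. Away from maximum welfare the costs
  \<open>c_i\<close> misstate the envy. This is harmless: the second component decides only between
  assignments of equal welfare, and the minimum already has maximum welfare.\<close>

instance prod :: (linordered_ab_group_add, linordered_ab_group_add) linordered_ab_group_add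
  by standard (auto simp: less_eq_prod_def)

section \<open>The assignment problem over an ordered abelian group\<close>

text \<open>
  Rows \<open>0, \<dots>, n - 1\<close> are inserted one at a time. While row \<open>k\<close> is being inserted, it is
  matched to the virtual column \<open>K\<close>, which makes the alternating tree and the augmentation uniform.
\<close>

locale assignment =
  fixes n K :: nat and C :: "nat \<Rightarrow> nat \<Rightarrow> 'g::linordered_ab_group_add"
  assumes n_le_K: "n \<le> K"
begin

text \<open>Dual feasibility for the linear program in which each row is matched exactly once and
  each column at most once: the equations leave \<open>u\<close> free, the inequalities force
  \<open>w\<close> to be nonpositive.\<close>

definition feasible :: "(nat \<Rightarrow> 'g) \<Rightarrow> (nat \<Rightarrow> 'g) \<Rightarrow> bool" where
  "feasible u w \<longleftrightarrow> (\<forall>i<n. \<forall>j<K. u i + w j \<le> C i j) \<and> (\<forall>j<K. w j \<le> 0)"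

definition tight :: "(nat \<Rightarrow> 'g) \<Rightarrow> (nat \<Rightarrow> 'g) \<Rightarrow> nat \<Rightarrow> nat \<Rightarrow> bool" where
  "tight u w i j \<longleftrightarrow> u i + w j = C i j"

text \<open>Complementary slackness for the rows inserted so far. Feasibility already covers all
  \<open>n\<close> rows, so a new row enters without any change of the duals.\<close>

definition optimal :: "nat \<Rightarrow> (nat \<Rightarrow> nat) \<Rightarrow> (nat \<Rightarrow> 'g) \<Rightarrow> (nat \<Rightarrow> 'g) \<Rightarrow> bool" where
  "optimal k M u w \<longleftrightarrow> inj_on M {..<k} \<and> M ` {..<k} \<subseteq> {..<K} \<and> feasible u w \<and>
     (\<forall>i<k. tight u w i (M i)) \<and> (\<forall>j<K. j \<notin> M ` {..<k} \<longrightarrow> w j = 0)"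

lemma optimal_sum_le:
  assumes M: "optimal n M u w" and B: "inj_on B {..<n}" "B ` {..<n} \<subseteq> {..<K}"
  shows "(\<Sum>i<n. C i (M i)) \<le> (\<Sum>i<n. C i (B i))"
proof -
  have inj: "inj_on M {..<n}" and ran: "M ` {..<n} \<subseteq> {..<K}"
    and out: "\<And>j. j < K \<Longrightarrow> j \<notin> M ` {..<n} \<Longrightarrow> w j = 0"
    and neg: "\<And>j. j < K \<Longrightarrow> w j \<le> 0"
    using M by (auto simp: optimal_def feasible_def)
  have "(\<Sum>i<n. C i (M i)) = (\<Sum>i<n. u i + w (M i))"
    using M by (intro sum.cong) (auto simp: optimal_def tight_def)
  also have "\<dots> = sum u {..<n} + sum w (M ` {..<n})"
    using inj by (simp add: sum.distrib sum.reindex)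
  also have "sum w (M ` {..<n}) = sum w {..<K}"
    using ran out by (intro sum.mono_neutral_left) auto
  also have "\<dots> \<le> sum w (B ` {..<n})"
    using sum_mono[of "{..<K} - B ` {..<n}" w "\<lambda>_. 0"] neg
      sum.subset_diff[OF B(2), of w] by simp
  also have "sum u {..<n} + sum w (B ` {..<n}) = (\<Sum>i<n. u i + w (B i))"
    using B(1) by (simp add: sum.distrib sum.reindex)
  also have "\<dots> \<le> (\<Sum>i<n. C i (B i))"
    using M B(2) by (intro sum_mono) (auto simp: optimal_def feasible_def)
  finally show ?thesis by simp
qed

text \<open>\<open>rank j\<close> is the time at which column \<open>j\<close> joined the alternating tree, \<open>0\<close> if it has not.\<close>

definition tree ::
  "nat \<Rightarrow> (nat \<Rightarrow> nat) \<Rightarrow> (nat \<Rightarrow> 'g) \<Rightarrow> (nat \<Rightarrow> 'g) \<Rightarrow> (nat \<Rightarrow> nat) \<Rightarrow> (nat \<Rightarrow> nat) \<Rightarrow> nat \<Rightarrow> bool"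
  where
  "tree k M u w rank parent r \<longleftrightarrow> (\<forall>j<K. 0 < rank j \<and> rank j \<le> r \<longrightarrow>
     parent j \<le> k \<and> tight u w (parent j) j \<and>
     0 < rank (M (parent j)) \<and> rank (M (parent j)) < rank j)"

text \<open>\<open>j0\<close> is the column that joined last, and the only one in the tree that may
  be unmatched, as the search stops there. By the cardinality equation \<open>r\<close> counts the
  columns of the tree including the virtual one, which bounds the number of steps.\<close>

definition searching ::
  "nat \<Rightarrow> (nat \<Rightarrow> nat) \<Rightarrow> (nat \<Rightarrow> 'g) \<Rightarrow> (nat \<Rightarrow> 'g) \<Rightarrow> (nat \<Rightarrow> nat) \<Rightarrow> (nat \<Rightarrow> nat) \<Rightarrow> nat \<Rightarrow> nat \<Rightarrow> bool"
  where
  "searching k M u w rank parent r j0 \<longleftrightarrow> k < n \<and> optimal k M u w \<and> M k = K \<and>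
     0 < rank K \<and> j0 \<le> K \<and> 0 < rank j0 \<and> (\<forall>j<K. 0 < rank j \<longrightarrow> j \<in> insert j0 (M ` {..<k})) \<and>
     tree k M u w rank parent r \<and> (\<forall>j\<le>K. rank j \<le> r) \<and>
     r + card {j. j < K \<and> rank j = 0} = Suc K"

lemma searching_start:
  assumes "optimal k M u w" "k < n" "\<And>j. j < K \<Longrightarrow> rank j = 0"
  shows "searching k (M(k := K)) u w (rank(K := 1)) parent 1 K"
proof -
  have "M(k := K) ` {..<k} = M ` {..<k}" "inj_on (M(k := K)) {..<k} = inj_on M {..<k}"
    by (auto simp: inj_on_def)
  moreover have "{j. j < K \<and> rank j = 0} = {..<K}" using assms(3) by auto
  moreover have "{j. j < K \<and> (rank(K := 1)) j = 0} = {j. j < K \<and> rank j = 0}" by auto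
  ultimately show ?thesis
    using assms by (auto simp: searching_def optimal_def tree_def)
qed

text \<open>The edges that leave the tree. A row belongs to the tree if its matched column does; row
  \<open>k\<close> does so through the virtual column.\<close>

definition candidate :: "nat \<Rightarrow> (nat \<Rightarrow> nat) \<Rightarrow> (nat \<Rightarrow> nat) \<Rightarrow> nat \<Rightarrow> nat \<Rightarrow> bool" where
  "candidate k M rank i j \<longleftrightarrow> i \<le> k \<and> 0 < rank (M i) \<and> j < K \<and> rank j = 0"

definition slack :: "(nat \<Rightarrow> 'g) \<Rightarrow> (nat \<Rightarrow> 'g) \<Rightarrow> nat \<Rightarrow> nat \<Rightarrow> 'g" where
  "slack u w i j = C i j - u i - w j"

text \<open>Pigeonhole: otherwise all \<open>K\<close> columns would be in the tree and hence
  matched by the \<open>k\<close> rows before row \<open>k\<close>, although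
  \<open>k < n \<le> K\<close>.\<close>

lemma candidate_exists:
  assumes "searching k M u w rank parent r j0" "j0 = K \<or> j0 \<in> M ` {..<k}"
  shows "\<exists>j. candidate k M rank k j"
proof (rule ccontr)
  assume "\<not> ?thesis"
  then have "{..<K} \<subseteq> M ` {..<k}"
    using assms by (auto simp: candidate_def searching_def)
  then have "K \<le> card (M ` {..<k})" using card_mono[of "M ` {..<k}" "{..<K}"] by simp
  also have "\<dots> \<le> k" using card_image_le[of "{..<k}" M] by simp
  finally show False using assms n_le_K by (simp add: searching_def)
qed

text \<open>Shifting rows and columns of the tree by the least slack in opposite directions keeps
  the tree edges tight, makes \<open>(i, j)\<close> tight and leaves every other candidate with
  nonnegative slack. Unmatched columns lie outside the tree before the step, so they keep price
  zero.\<close>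

lemma searching_step:
  assumes S: "searching k M u w rank parent r j0" and j0: "j0 = K \<or> j0 \<in> M ` {..<k}"
    and ij: "candidate k M rank i j"
    and min: "\<And>i' j'. candidate k M rank i' j' \<Longrightarrow> slack u w i j \<le> slack u w i' j'"
  defines "u' \<equiv> \<lambda>x. if x \<le> k \<and> 0 < rank (M x) then u x + slack u w i j else u x"
    and "w' \<equiv> \<lambda>x. if x < K \<and> 0 < rank x then w x - slack u w i j else w x"
  shows "searching k M u' w' (rank(j := Suc r)) (parent(j := i)) (Suc r) j"
proof -
  define d where "d = slack u w i j"
  have kn: "k < n" and opt: "optimal k M u w" and Mk: "M k = K" and rK: "0 < rank K"
    and T: "\<And>x. x < K \<Longrightarrow> 0 < rank x \<Longrightarrow> x \<in> M ` {..<k}"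
    and tr: "tree k M u w rank parent r" and rr: "\<And>x. x \<le> K \<Longrightarrow> rank x \<le> r"
    and card: "r + card {j. j < K \<and> rank j = 0} = Suc K"
    using S j0 by (auto simp: searching_def)
  have inj: "inj_on M {..<k}" and ran: "\<And>x. x < k \<Longrightarrow> M x < K" and feas: "feasible u w"
    and ti: "\<And>x. x < k \<Longrightarrow> tight u w x (M x)"
    and out: "\<And>x. x < K \<Longrightarrow> x \<notin> M ` {..<k} \<Longrightarrow> w x = 0"
    using opt by (auto simp: optimal_def)
  have ij': "i \<le> k" "0 < rank (M i)" "j < K" "rank j = 0"
    using ij by (auto simp: candidate_def)
  have d0: "0 \<le> d"
    using feas ij' kn by (auto simp: d_def feasible_def slack_def algebra_simps)
  have u'_le: "u' x \<le> u x + d" and w'_le: "w' x \<le> w x" for x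
    using d0 by (auto simp: u'_def w'_def d_def[symmetric])
  have "u' a + w' b \<le> C a b" if "a < n" "b < K" for a b
  \<comment> \<open>Only candidate edges lose slack; on all others the change is zero or in favour
    of feasibility.\<close>
  proof (cases "a \<le> k \<and> 0 < rank (M a) \<and> rank b = 0")
    case True
    then have "d \<le> slack u w a b" using that min[of a b] by (auto simp: candidate_def d_def)
    then have "u a + d + w b \<le> C a b" by (simp add: slack_def algebra_simps)
    then show ?thesis using True by (simp add: u'_def w'_def d_def[symmetric])
  next
    case False
    then have "u' a + w' b \<le> u a + w b"
      using that d0 by (auto simp: u'_def w'_def d_def[symmetric] algebra_simps)
    also have "\<dots> \<le> C a b" using feas that by (simp add: feasible_def)
    finally show ?thesis .
  qed
  moreover have "w' b \<le> 0" if "b < K" for b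
    using w'_le[of b] feas that by (auto simp: feasible_def intro: order_trans)
  ultimately have feas': "feasible u' w'" by (simp add: feasible_def)
  \<comment> \<open>With both ends in the tree the two shifts cancel, with both outside nothing
    changes.\<close>
  have keep: "tight u' w' a b" if "tight u w a b" "a \<le> k" "b < K" "0 < rank (M a) \<longleftrightarrow> 0 < rank b"
    for a b using that by (auto simp: tight_def u'_def w'_def algebra_simps)
  have opt': "optimal k M u' w'"
    unfolding optimal_def using inj ran feas' keep[OF ti] out T
    by (auto simp: w'_def image_subset_iff)
  have tij: "tight u' w' i j"
    using ij' by (simp add: tight_def u'_def w'_def slack_def algebra_simps)
  have ran': "M x \<le> K" if "x \<le> k" for x
    using ran[of x] Mk that by (cases "x = k") auto
  have ne: "M x \<noteq> j" if "0 < rank (M x)" for x using ij' that by auto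
  have tr': "tree k M u' w' (rank(j := Suc r)) (parent(j := i)) (Suc r)"
    unfolding tree_def
  proof (intro allI impI)
    fix x assume x: "x < K" "0 < (rank(j := Suc r)) x \<and> (rank(j := Suc r)) x \<le> Suc r"
    show "(parent(j := i)) x \<le> k \<and> tight u' w' ((parent(j := i)) x) x \<and>
      0 < (rank(j := Suc r)) (M ((parent(j := i)) x)) \<and>
      (rank(j := Suc r)) (M ((parent(j := i)) x)) < (rank(j := Suc r)) x"
    proof (cases "x = j")
      case True
      then show ?thesis using ij' tij ne[of i] rr[OF ran'[of i]] by simp
    next
      case False
      then have *: "parent x \<le> k" "tight u w (parent x) x" "0 < rank (M (parent x))"
        "rank (M (parent x)) < rank x"
        using tr x rr[of x] by (auto simp: tree_def)
      then show ?thesis using False ne[of "parent x"] keep[of "parent x" x] x by auto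
    qed
  qed
  have "{x. x < K \<and> rank x = 0} = insert j {x. x < K \<and> (rank(j := Suc r)) x = 0}"
    using ij' by auto
  then have "card {x. x < K \<and> rank x = 0} = Suc (card {x. x < K \<and> (rank(j := Suc r)) x = 0})"
    by (simp add: card_insert_if)
  then show ?thesis
    unfolding searching_def using kn opt' Mk rK ij' T tr' rr card by (auto simp: le_SucI)
qed

text \<open>
  During the augmentation the matching stays tight and has a single hole \<open>j0\<close>, which moves towards
  the virtual column along columns of decreasing rank.
\<close>

definition augmenting ::
  "nat \<Rightarrow> (nat \<Rightarrow> nat) \<Rightarrow> (nat \<Rightarrow> 'g) \<Rightarrow> (nat \<Rightarrow> 'g) \<Rightarrow> (nat \<Rightarrow> nat) \<Rightarrow> (nat \<Rightarrow> nat) \<Rightarrow> nat \<Rightarrow> bool"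
  where
  "augmenting k M u w rank parent j0 \<longleftrightarrow> inj_on M {..k} \<and> M ` {..k} \<subseteq> {..K} \<and>
     j0 \<le> K \<and> j0 \<notin> M ` {..k} \<and> 0 < rank j0 \<and> feasible u w \<and>
     (\<forall>i\<le>k. M i \<noteq> K \<longrightarrow> tight u w i (M i)) \<and>
     (\<forall>j<K. j \<notin> insert j0 (M ` {..k}) \<longrightarrow> w j = 0) \<and> tree k M u w rank parent (rank j0)"

text \<open>The free column found by the search is the hole. Row \<open>k\<close> sits on the
  virtual column, the one place where a matched edge need not be tight.\<close>

lemma augmenting_start:
  assumes S: "searching k M u w rank parent r j0" and "j0 \<noteq> K" "j0 \<notin> M ` {..<k}"
  shows "augmenting k M u w rank parent j0"
proof -
  have k: "{..k} = insert k {..<k}" by auto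
  have ran: "M ` {..<k} \<subseteq> {..<K}" and "inj_on M {..<k}" and Mk: "M k = K"
    using S by (auto simp: searching_def optimal_def)
  then have "inj_on M {..k}" unfolding k by auto
  moreover have "M ` {..k} = insert K (M ` {..<k})" unfolding k using Mk by simp
  moreover have "tree k M u w rank parent (rank j0)"
    using S by (auto simp: searching_def tree_def)
  moreover have "tight u w i (M i)" if "i \<le> k" "M i \<noteq> K" for i
    using S that Mk by (cases "i = k") (auto simp: searching_def optimal_def)
  ultimately show ?thesis
    using S assms(2,3) ran by (auto simp: augmenting_def searching_def optimal_def)
qed

text \<open>The parent of the hole moves into it along a tight edge and leaves its old column, of
  smaller rank, as the new hole. By the third claim the occupied columns together with the hole form
  a fixed set, so the program marks occupancy once per phase.\<close>

lemma augmenting_step: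
  assumes A: "augmenting k M u w rank parent j0" and "j0 \<noteq> K"
  defines "i \<equiv> parent j0"
  shows "augmenting k (M(i := j0)) u w rank parent (M i)"
    and "rank (M i) < rank j0"
    and "insert (M i) ((M(i := j0)) ` {..k}) = insert j0 (M ` {..k})"
proof -
  have i: "i \<le> k" "tight u w i j0" "0 < rank (M i)" "rank (M i) < rank j0"
    using A \<open>j0 \<noteq> K\<close> by (auto simp: augmenting_def tree_def i_def)
  have inj: "inj_on M {..k}" and ran: "M ` {..k} \<subseteq> {..K}"
    and j0: "j0 \<le> K" "j0 \<notin> M ` {..k}" and feas: "feasible u w"
    and ti: "\<And>x. x \<le> k \<Longrightarrow> M x \<noteq> K \<Longrightarrow> tight u w x (M x)"
    and out: "\<And>x. x < K \<Longrightarrow> x \<notin> insert j0 (M ` {..k}) \<Longrightarrow> w x = 0"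
    and tr: "tree k M u w rank parent (rank j0)"
    using A by (auto simp: augmenting_def)
  have im: "(M(i := j0)) ` {..k} = insert j0 (M ` ({..k} - {i}))" using i by auto
  show eq: "insert (M i) ((M(i := j0)) ` {..k}) = insert j0 (M ` {..k})"
    unfolding im using i by auto
  show "rank (M i) < rank j0" by fact
  have "inj_on (M(i := j0)) {..k}" using inj j0 by (auto simp: inj_on_def)
  moreover have "M i \<notin> (M(i := j0)) ` {..k}"
    unfolding im using inj i j0 by (auto simp: inj_on_def)
  moreover have "(M(i := j0)) ` {..k} \<subseteq> {..K}" unfolding im using ran j0 by auto
  moreover have "tree k (M(i := j0)) u w rank parent (rank (M i))"
    unfolding tree_def
  proof (intro allI impI)
    fix x assume x: "x < K" "0 < rank x \<and> rank x \<le> rank (M i)"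
    then have *: "parent x \<le> k \<and> tight u w (parent x) x \<and> 0 < rank (M (parent x)) \<and>
      rank (M (parent x)) < rank x" using tr i by (auto simp: tree_def)
    \<comment> \<open>The column of \<open>parent x\<close> has rank below \<open>rank x\<close>,
      which is at most \<open>rank (M i)\<close>; so the moved row is no parent in the part of the
      tree that is still used.\<close>
    then have "parent x \<noteq> i" using x by auto
    then show "parent x \<le> k \<and> tight u w (parent x) x \<and>
      0 < rank ((M(i := j0)) (parent x)) \<and> rank ((M(i := j0)) (parent x)) < rank x"
      using * by simp
  qed
  ultimately show "augmenting k (M(i := j0)) u w rank parent (M i)"
    unfolding augmenting_def eq using i ran feas ti out by auto
qed

text \<open>Once the virtual column is the hole no row occupies it, so the exemption from tightness
  is void.\<close>

lemma augmenting_end: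
  assumes A: "augmenting k M u w rank parent K"
  shows "optimal (Suc k) M u w"
proof -
  have "M i < K" if "i \<le> k" for i
    using A that unfolding augmenting_def
    by (metis atMost_iff image_eqI image_subset_iff le_neq_implies_less)
  then show ?thesis
    using A unfolding augmenting_def optimal_def lessThan_Suc_atMost
    by (auto simp: less_Suc_eq_le)
qed

end

section \<open>Total correctness within a polynomial time bound\<close>

text \<open>Every loop is granted \<open>N + 2\<close> iterations.\<close>

primrec time_poly :: "com \<Rightarrow> nat poly" where
  "time_poly Skip = 1"
| "time_poly (NStore x a b e) = 1"
| "time_poly (RStore x a b e) = 1"
| "time_poly (Seq c d) = time_poly c + time_poly d"
| "time_poly (If b c d) = 1 + time_poly c + time_poly d"
| "time_poly (While b c) = [:2, 1:] * (1 + time_poly c) + 1"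

text \<open>The time bound is fixed by the program text and \<open>N\<close>, so assertions need no
  step counter.\<close>

definition wp :: "nat \<Rightarrow> com \<Rightarrow> (state \<Rightarrow> bool) \<Rightarrow> state \<Rightarrow> bool" where
  "wp N c Q s \<longleftrightarrow> (\<exists>t s'. exec c s t s' \<and> t \<le> poly (time_poly c) N \<and> Q s')"

section \<open>Frame conditions from syntactic write sets\<close>

primrec nwrites :: "com \<Rightarrow> name set" where
  "nwrites Skip = {}"
| "nwrites (NStore x a b e) = {x}"
| "nwrites (RStore x a b e) = {}"
| "nwrites (Seq c d) = nwrites c \<union> nwrites d"
| "nwrites (If b c d) = nwrites c \<union> nwrites d"
| "nwrites (While b c) = nwrites c"

primrec rwrites :: "com \<Rightarrow> name set" where
  "rwrites Skip = {}"
| "rwrites (NStore x a b e) = {}"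
| "rwrites (RStore x a b e) = {x}"
| "rwrites (Seq c d) = rwrites c \<union> rwrites d"
| "rwrites (If b c d) = rwrites c \<union> rwrites d"
| "rwrites (While b c) = rwrites c"

definition frame :: "com \<Rightarrow> state \<Rightarrow> state \<Rightarrow> bool" where
  "frame c s s' \<longleftrightarrow> (\<forall>x. x \<notin> nwrites c \<longrightarrow> nmem s' x = nmem s x) \<and>
     (\<forall>x. x \<notin> rwrites c \<longrightarrow> rmem s' x = rmem s x)"

lemma frame_nmem: "frame c s s' \<Longrightarrow> x \<notin> nwrites c \<Longrightarrow> nmem s' x = nmem s x"
  and frame_rmem: "frame c s s' \<Longrightarrow> x \<notin> rwrites c \<Longrightarrow> rmem s' x = rmem s x"
  by (simp_all add: frame_def)

lemma frame_refl: "frame c s s"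
  by (simp add: frame_def)

lemma frame_trans: "frame c s s' \<Longrightarrow> frame c s' s'' \<Longrightarrow> frame c s s''"
  by (simp add: frame_def)

lemma upd_apply: "upd f x i j y x' i' j' = (if x' = x \<and> i' = i \<and> j' = j then y else f x' i' j')"
  by (simp add: upd_def)

lemma upd_other: "x' \<noteq> x \<Longrightarrow> upd f x i j y x' = f x'"
  by (simp add: upd_def)

lemma upd_row: "upd f x i j y x' i' = (if x' = x \<and> i' = i then (f x i)(j := y) else f x' i')"
  by (simp add: upd_def)

lemma exec_frame: "exec c s t s' \<Longrightarrow> frame c s s'"
  by (induction rule: exec.induct) (auto simp: frame_def upd_other)

text \<open>The consequence rule supplies the frame for free, so specifications need not list the
  arrays that stay unchanged.\<close>

lemma wp_mono: "wp N c P s \<Longrightarrow> (\<And>s'. P s' \<Longrightarrow> frame c s s' \<Longrightarrow> Q s') \<Longrightarrow> wp N c Q s"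
  unfolding wp_def using exec_frame by blast

lemma wp_Skip: "Q s \<Longrightarrow> wp N Skip Q s"
  unfolding wp_def by (auto intro!: exI exec.Skip)

lemma wp_NStore:
  "Q (s\<lparr>nmem := upd (nmem s) x (nval a s) (nval b s) (nval e s)\<rparr>) \<Longrightarrow> wp N (NStore x a b e) Q s"
  unfolding wp_def by (intro exI conjI, rule exec.NStore) auto

lemma wp_RStore:
  "Q (s\<lparr>rmem := upd (rmem s) x (nval a s) (nval b s) (rval e s)\<rparr>) \<Longrightarrow> wp N (RStore x a b e) Q s"
  unfolding wp_def by (intro exI conjI, rule exec.RStore) auto

lemma wp_Seq:
  assumes "wp N c (wp N d Q) s"
  shows "wp N (Seq c d) Q s"
proof -
  obtain t s' u s'' where "exec c s t s'" "t \<le> poly (time_poly c) N"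
    "exec d s' u s''" "u \<le> poly (time_poly d) N" "Q s''"
    using assms unfolding wp_def by blast
  then show ?thesis
    unfolding wp_def by (intro exI[of _ "t + u"] exI[of _ s'']) (auto intro: exec.Seq)
qed

lemma wp_If:
  assumes "bval b s \<Longrightarrow> wp N c Q s" "\<not> bval b s \<Longrightarrow> wp N d Q s"
  shows "wp N (If b c d) Q s"
proof (cases "bval b s")
  case True
  then obtain t s' where "exec c s t s'" "t \<le> poly (time_poly c) N" "Q s'"
    using assms(1) unfolding wp_def by blast
  then show ?thesis
    unfolding wp_def using True by (intro exI[of _ "Suc t"] exI[of _ s']) (auto intro: exec.IfTrue)
next
  case False
  then obtain t s' where "exec d s t s'" "t \<le> poly (time_poly d) N" "Q s'"
    using assms(2) unfolding wp_def by blast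
  then show ?thesis
    unfolding wp_def using False
    by (intro exI[of _ "Suc t"] exI[of _ s']) (auto intro: exec.IfFalse)
qed

text \<open>Invariant and exit may use the frame relative to the entry state of the whole loop, not
  just of one iteration.\<close>

lemma wp_While:
  fixes \<mu> :: "state \<Rightarrow> nat"
  assumes init: "I s" "\<mu> s \<le> N + 2"
    and step: "\<And>s'. I s' \<Longrightarrow> frame c s s' \<Longrightarrow> bval b s' \<Longrightarrow> wp N c (\<lambda>s''. I s'' \<and> \<mu> s'' < \<mu> s') s'"
    and exit: "\<And>s'. I s' \<Longrightarrow> frame c s s' \<Longrightarrow> \<not> bval b s' \<Longrightarrow> Q s'"
  shows "wp N (While b c) Q s"
proof -
  define T where "T = poly (time_poly c) N"
  \<comment> \<open>The bound is stated in the current measure so that the induction adds up; the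
    final \<open>1\<close> pays for the failing test. \<open>N\<close> enters only at the
    end.\<close>
  have "\<exists>t s''. exec (While b c) s' t s'' \<and> t \<le> \<mu> s' * Suc T + 1 \<and> Q s''"
    if "I s'" "frame c s s'" for s'
    using that
  proof (induction "\<mu> s'" arbitrary: s' rule: less_induct)
    case less
    show ?case
    proof (cases "bval b s'")
      case True
      then obtain t s'' where t: "exec c s' t s''" "t \<le> T" "I s''" "\<mu> s'' < \<mu> s'"
        using step[OF less.prems] unfolding wp_def T_def by blast
      moreover have "frame c s s''" using less.prems(2) exec_frame[OF t(1)] by (rule frame_trans)
      ultimately obtain u s3 where u: "exec (While b c) s'' u s3" "u \<le> \<mu> s'' * Suc T + 1" "Q s3"
        using less.hyps by blast
      have "Suc (t + u) \<le> Suc T + (\<mu> s'' * Suc T + 1)" using t u by simp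
      also have "\<dots> = Suc (\<mu> s'') * Suc T + 1" by simp
      also have "\<dots> \<le> \<mu> s' * Suc T + 1" using t(4) by (intro add_right_mono mult_right_mono) auto
      finally show ?thesis using exec.WhileTrue[OF True t(1) u(1)] u(3) by blast
    next
      case False
      then show ?thesis using exit[OF less.prems] exec.WhileFalse[OF False]
        by (intro exI[of _ 1] exI[of _ s']) auto
    qed
  qed
  from this[OF init(1) frame_refl] obtain t s''
    where t: "exec (While b c) s t s''" "t \<le> \<mu> s * Suc T + 1" "Q s''" by blast
  have "\<mu> s * Suc T \<le> (N + 2) * Suc T" using init(2) by (rule mult_right_mono) simp
  then have "t \<le> poly (time_poly (While b c)) N" using t(2) by (simp add: T_def algebra_simps)
  then show ?thesis using t unfolding wp_def by blast
qed

abbreviation Var :: "name \<Rightarrow> nexp" where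
  "Var x \<equiv> NLoad x (NConst 0) (NConst 0)"

abbreviation Set :: "name \<Rightarrow> nexp \<Rightarrow> com" where
  "Set x e \<equiv> NStore x (NConst 0) (NConst 0) e"

abbreviation setn :: "state \<Rightarrow> name \<Rightarrow> nat \<Rightarrow> state" where
  "setn s x y \<equiv> s\<lparr>nmem := upd (nmem s) x 0 0 y\<rparr>"

definition For :: "name \<Rightarrow> nexp \<Rightarrow> com \<Rightarrow> com" where
  "For x e c = Seq (Set x (NConst 0))
     (While (NLess (Var x) e) (Seq c (Set x (NAdd (Var x) (NConst 1)))))"

lemma writes_For [simp]:
  "nwrites (For x e c) = insert x (nwrites c)" "rwrites (For x e c) = rwrites c"
  by (auto simp: For_def)

text \<open>The limit \<open>e\<close> is evaluated anew at every test, so it must have the value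
  \<open>b\<close> in all states that the frame of the loop admits.\<close>

lemma wp_For:
  assumes x: "x \<notin> nwrites c"
    and bound: "\<And>s'. frame (For x e c) s s' \<Longrightarrow> nval e s' = b" "b \<le> N + 2"
    and init: "I 0 (setn s x 0)"
    and step: "\<And>i s'. I i s' \<Longrightarrow> i < b \<Longrightarrow> nmem s' x 0 0 = i \<Longrightarrow> frame (For x e c) s s' \<Longrightarrow>
      wp N c (\<lambda>s''. I (Suc i) (setn s'' x (Suc i))) s'"
    and exit: "\<And>s'. I b s' \<Longrightarrow> frame (For x e c) s s' \<Longrightarrow> Q s'"
  shows "wp N (For x e c) Q s"
proof -
  let ?body = "Seq c (Set x (NAdd (Var x) (NConst 1)))"
  let ?s = "setn s x 0"
  have frame: "frame (For x e c) s s'" if "frame ?body ?s s'" for s'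
    using that by (auto simp: frame_def upd_other)
  have "wp N (While (NLess (Var x) e) ?body) Q ?s"
  proof (rule wp_While[where I = "\<lambda>s'. nmem s' x 0 0 \<le> b \<and> I (nmem s' x 0 0) s'"
      and \<mu> = "\<lambda>s'. b - nmem s' x 0 0"])
    show "nmem ?s x 0 0 \<le> b \<and> I (nmem ?s x 0 0) ?s" using init by (simp add: upd_apply)
    show "b - nmem ?s x 0 0 \<le> N + 2" using bound(2) by simp
  next
    fix s' assume s': "nmem s' x 0 0 \<le> b \<and> I (nmem s' x 0 0) s'"
      and f: "frame ?body ?s s'" and "bval (NLess (Var x) e) s'"
    then have lt: "nmem s' x 0 0 < b" using bound(1)[OF frame[OF f]] by simp
    have "wp N c (\<lambda>s''. I (Suc (nmem s' x 0 0)) (setn s'' x (Suc (nmem s' x 0 0)))) s'"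
      using step s' lt frame[OF f] by blast
    then show "wp N ?body (\<lambda>s''. (nmem s'' x 0 0 \<le> b \<and> I (nmem s'' x 0 0) s'') \<and>
      b - nmem s'' x 0 0 < b - nmem s' x 0 0) s'"
      by (rule wp_Seq[OF wp_mono], intro wp_NStore)
        (use x lt in \<open>auto simp: frame_nmem upd_apply\<close>)
  next
    fix s' assume s': "nmem s' x 0 0 \<le> b \<and> I (nmem s' x 0 0) s'"
      and f: "frame ?body ?s s'" and nb: "\<not> bval (NLess (Var x) e) s'"
    then have "nmem s' x 0 0 = b" using bound(1)[OF frame[OF f]] by simp
    then show "Q s'" using exit s' frame[OF f] by auto
  qed
  then show ?thesis unfolding For_def by (intro wp_Seq wp_NStore) simp
qed

section \<open>The program\<close>

abbreviation Disj :: "bexp \<Rightarrow> bexp \<Rightarrow> bexp" where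
  "Disj a b \<equiv> Neg (Conj (Neg a) (Neg b))"

abbreviation Pos :: "nexp \<Rightarrow> bexp" where
  "Pos e \<equiv> NLess (NConst 0) e"

abbreviation At :: "name \<Rightarrow> nexp \<Rightarrow> nexp" where
  "At x e \<equiv> NLoad x e (NConst 0)"

text \<open>
  The columns \<open>m, \<dots>, K - 1\<close> with \<open>K = n + m\<close> stand for the empty bundle. They need no special
  treatment, because the input array is zero there. The sum of all values of an agent is part of
  its costs to make them non-negative, so that the duals, which start as zero, are feasible.
\<close>

definition cost_cell_com :: com where
  "cost_cell_com = Seq
     (For ''h'' (Var ''m'') (Seq
       (RStore ''a'' (Var ''i'') (Var ''j'')
         (RAdd (RLoad ''a'' (Var ''i'') (Var ''j'')) (RLoad ''v'' (Var ''i'') (Var ''h''))))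
       (If (RLess (RLoad ''v'' (Var ''i'') (Var ''j'')) (RLoad ''v'' (Var ''i'') (Var ''h'')))
         (RStore ''b'' (Var ''i'') (Var ''j'')
           (RAdd (RLoad ''b'' (Var ''i'') (Var ''j''))
             (RSub (RLoad ''v'' (Var ''i'') (Var ''h'')) (RLoad ''v'' (Var ''i'') (Var ''j'')))))
         Skip)))
     (RStore ''a'' (Var ''i'') (Var ''j'')
       (RSub (RLoad ''a'' (Var ''i'') (Var ''j'')) (RLoad ''v'' (Var ''i'') (Var ''j''))))"

definition cost_com :: com where
  "cost_com = For ''i'' (Var ''n'') (For ''j'' (Var ''K'') cost_cell_com)"

text \<open>The two components of a dual are columns 0 and 1 of one array, selected by
  \<open>c\<close>; the costs already use both indices and need two arrays \<open>a\<close> and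
  \<open>b\<close>.\<close>

definition slack_exp :: "name \<Rightarrow> nat \<Rightarrow> nexp \<Rightarrow> nexp \<Rightarrow> rexp" where
  "slack_exp x c i j =
     RSub (RSub (RLoad x i j) (RLoad ''u'' i (NConst c))) (RLoad ''w'' j (NConst c))"

text \<open>Lexicographic order: where the first disjunct fails, excluding the reverse inequality
  leaves equal first components.\<close>

definition slack_less :: bexp where
  "slack_less = Disj
     (RLess (slack_exp ''a'' 0 (Var ''i'') (Var ''j'')) (slack_exp ''a'' 0 (Var ''bi'') (Var ''bj'')))
     (Conj
       (Neg (RLess (slack_exp ''a'' 0 (Var ''bi'') (Var ''bj''))
         (slack_exp ''a'' 0 (Var ''i'') (Var ''j''))))
       (RLess (slack_exp ''b'' 1 (Var ''i'') (Var ''j''))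
         (slack_exp ''b'' 1 (Var ''bi'') (Var ''bj''))))"

text \<open>The flag \<open>f\<close> replaces an infinite initial minimum, for which there is no
  constant. Positions are stored instead of slacks.\<close>

definition find_com :: com where
  "find_com = Seq (Set ''f'' (NConst 0))
     (For ''i'' (NAdd (Var ''k'') (NConst 1))
       (If (Pos (NLoad ''rank'' (Var ''k'') (At ''M'' (Var ''i''))))
         (For ''j'' (Var ''K'')
           (If (Conj (Neg (Pos (NLoad ''rank'' (Var ''k'') (Var ''j''))))
                (Disj (Neg (Pos (Var ''f''))) slack_less))
             (Seq (Set ''f'' (NConst 1)) (Seq (Set ''bi'' (Var ''i'')) (Set ''bj'' (Var ''j''))))
             Skip))
         Skip))"

definition shift_com :: "name \<Rightarrow> nat \<Rightarrow> name \<Rightarrow> nexp \<Rightarrow> nexp \<Rightarrow> com" where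
  "shift_com y c x e b = For x e (If (Pos b)
     (Seq
       (RStore y (Var x) (NConst 0) (RAdd (RLoad y (Var x) (NConst 0))
         (RLoad ''d'' (NConst c) (NConst 0))))
       (RStore y (Var x) (NConst 1) (RAdd (RLoad y (Var x) (NConst 1))
         (RLoad ''d'' (NConst c) (NConst 1)))))
     Skip)"

text \<open>Row \<open>0\<close> of the array \<open>d\<close> is the minimal slack, row \<open>1\<close> is its negative.\<close>

definition dual_com :: com where
  "dual_com = Seq
     (RStore ''d'' (NConst 0) (NConst 0) (slack_exp ''a'' 0 (Var ''bi'') (Var ''bj'')))
     (Seq (RStore ''d'' (NConst 0) (NConst 1) (slack_exp ''b'' 1 (Var ''bi'') (Var ''bj'')))
     (Seq (RStore ''d'' (NConst 1) (NConst 0)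
       (RSub (RConst 0) (RLoad ''d'' (NConst 0) (NConst 0))))
     (Seq (RStore ''d'' (NConst 1) (NConst 1)
       (RSub (RConst 0) (RLoad ''d'' (NConst 0) (NConst 1))))
     (Seq
       (shift_com ''u'' 0 ''i'' (NAdd (Var ''k'') (NConst 1))
         (NLoad ''rank'' (Var ''k'') (At ''M'' (Var ''i''))))
       (shift_com ''w'' 1 ''j'' (Var ''K'') (NLoad ''rank'' (Var ''k'') (Var ''j'')))))))"

text \<open>The virtual column is marked as occupied before the phases, so the loop is entered at
  \<open>j0 = K\<close> and left at the first free column.\<close>

definition search_com :: com where
  "search_com = While (Pos (At ''occ'' (Var ''j0'')))
     (Seq find_com (Seq dual_com
       (Seq (Set ''r'' (NAdd (Var ''r'') (NConst 1)))
       (Seq (NStore ''rank'' (Var ''k'') (Var ''bj'') (Var ''r''))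
       (Seq (NStore ''parent'' (Var ''k'') (Var ''bj'') (Var ''bi''))
         (Set ''j0'' (Var ''bj'')))))))"

definition augment_com :: com where
  "augment_com = Seq (NStore ''occ'' (Var ''j0'') (NConst 0) (NConst 1))
     (While (NLess (Var ''j0'') (Var ''K''))
       (Seq (Set ''i'' (NLoad ''parent'' (Var ''k'') (Var ''j0'')))
       (Seq (Set ''h'' (At ''M'' (Var ''i'')))
       (Seq (NStore ''M'' (Var ''i'') (NConst 0) (Var ''j0''))
         (Set ''j0'' (Var ''h''))))))"

text \<open>Each phase uses its own row of the arrays \<open>rank\<close> and \<open>parent\<close>, so nothing has to be cleared.\<close>

definition phase_com :: com where
  "phase_com = Seq (NStore ''M'' (Var ''k'') (NConst 0) (Var ''K''))
     (Seq (NStore ''rank'' (Var ''k'') (Var ''K'') (NConst 1))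
     (Seq (Set ''r'' (NConst 1))
     (Seq (Set ''j0'' (Var ''K''))
     (Seq search_com augment_com))))"

definition output_com :: com where
  "output_com = For ''i'' (Var ''n'')
     (If (NLess (At ''M'' (Var ''i'')) (Var ''m''))
       (NStore ''out'' (Var ''i'') (NConst 0) (NAdd (At ''M'' (Var ''i'')) (NConst 1)))
       Skip)"

definition house_com :: com where
  "house_com = Seq (Set ''K'' (NAdd (Var ''n'') (Var ''m'')))
     (Seq cost_com
     (Seq (NStore ''occ'' (Var ''K'') (NConst 0) (NConst 1))
     (Seq (For ''k'' (Var ''n'') phase_com) output_com)))"

lemma writes_cost_cell_com [simp]:
  "nwrites cost_cell_com = {''h''}" "rwrites cost_cell_com = {''a'', ''b''}"
  by (auto simp: cost_cell_com_def)

lemma writes_cost_com [simp]: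
  "nwrites cost_com = {''i'', ''j'', ''h''}" "rwrites cost_com = {''a'', ''b''}"
  by (auto simp: cost_com_def)

lemma writes_find_com [simp]:
  "nwrites find_com = {''f'', ''i'', ''j'', ''bi'', ''bj''}" "rwrites find_com = {}"
  by (auto simp: find_com_def)

lemma writes_shift_com [simp]:
  "nwrites (shift_com y c x e b) = {x}" "rwrites (shift_com y c x e b) = {y}"
  by (auto simp: shift_com_def)

lemma writes_dual_com [simp]:
  "nwrites dual_com = {''i'', ''j''}" "rwrites dual_com = {''d'', ''u'', ''w''}"
  by (auto simp: dual_com_def)

lemma writes_search_com [simp]:
  "nwrites search_com = {''f'', ''i'', ''j'', ''bi'', ''bj'', ''r'', ''rank'', ''parent'', ''j0''}"
  "rwrites search_com = {''d'', ''u'', ''w''}"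
  by (auto simp: search_com_def)

lemma writes_augment_com [simp]:
  "nwrites augment_com = {''occ'', ''i'', ''h'', ''M'', ''j0''}" "rwrites augment_com = {}"
  by (auto simp: augment_com_def)

lemma writes_phase_com [simp]:
  "nwrites phase_com =
    {''f'', ''i'', ''j'', ''bi'', ''bj'', ''r'', ''rank'', ''parent'', ''j0'', ''occ'', ''h'', ''M''}"
  "rwrites phase_com = {''d'', ''u'', ''w''}"
  by (auto simp: phase_com_def)

lemma writes_output_com [simp]:
  "nwrites output_com = {''i'', ''out''}" "rwrites output_com = {}"
  by (auto simp: output_com_def)

section \<open>Correctness of the program\<close>

definition value_cost :: "(nat \<Rightarrow> nat \<Rightarrow> real) \<Rightarrow> nat \<Rightarrow> nat \<Rightarrow> real \<Rightarrow> real \<times> real" where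
  "value_cost v m i x = ((\<Sum>h<m. v i h) - x, \<Sum>h<m. max (v i h - x) 0)"

abbreviation costs :: "state \<Rightarrow> nat \<Rightarrow> nat \<Rightarrow> real \<times> real" where
  "costs s i j \<equiv> (rmem s ''a'' i j, rmem s ''b'' i j)"

lemma wp_cost_cell_com:
  assumes m: "nmem s ''m'' 0 0 = m" "m \<le> N"
    and ij: "nmem s ''i'' 0 0 = i" "nmem s ''j'' 0 0 = j" and zero: "costs s i j = 0"
    and v: "v = rmem s ''v''"
    and Q: "\<And>s'. frame cost_cell_com s s' \<Longrightarrow>
      (\<And>i' j'. costs s' i' j' =
        (if i' = i \<and> j' = j then value_cost v m i (v i j) else costs s i' j')) \<Longrightarrow> Q s'"
  shows "wp N cost_cell_com Q s"
proof -
  have "wp N cost_cell_com (\<lambda>s'. \<forall>i' j'. costs s' i' j' =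
        (if i' = i \<and> j' = j then value_cost v m i (v i j) else costs s i' j')) s"
    unfolding cost_cell_com_def
  \<comment> \<open>The value of the cell itself is subtracted only after the loop; adding
    \<open>(v i j, 0)\<close> undoes this, and \<open>value_cost v h\<close> sums over the first
    \<open>h\<close> houses.\<close>
  proof (rule wp_Seq, rule wp_For[where b = m and I = "\<lambda>h s'. \<forall>i' j'. costs s' i' j' =
        (if i' = i \<and> j' = j then value_cost v h i (v i j) + (v i j, 0) else costs s i' j')"], goal_cases)
    case (5 h s')
    have max: "max (y - x) 0 = (if x < y then y - x else 0)" for x y :: real by simp
    have a: "rmem s' ''a'' i' j' = (if i' = i \<and> j' = j then \<Sum>h<h. v i h else rmem s ''a'' i' j')"
      and b: "rmem s' ''b'' i' j' =
        (if i' = i \<and> j' = j then \<Sum>h<h. max (v i h - v i j) 0 else rmem s ''b'' i' j')" for i' j'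
      using 5(1)[rule_format, of i' j'] by (auto simp: value_cost_def)
    show ?case
      by (intro wp_Seq wp_RStore wp_If wp_Skip; use 5(2-) ij v in \<open>simp add: frame_nmem frame_rmem
            upd_apply upd_other value_cost_def a b max\<close>)
  next
    case (6 s')
    have a: "rmem s' ''a'' i' j' = (if i' = i \<and> j' = j then \<Sum>h<m. v i h else rmem s ''a'' i' j')"
      and b: "rmem s' ''b'' i' j' =
        (if i' = i \<and> j' = j then \<Sum>h<m. max (v i h - v i j) 0 else rmem s ''b'' i' j')" for i' j'
      using 6(1)[rule_format, of i' j'] by (auto simp: value_cost_def)
    show ?case
      by (intro wp_RStore) (use 6(2) ij v in \<open>simp add: frame_nmem frame_rmem upd_apply upd_other
            value_cost_def a b\<close>)
  qed (use m zero in \<open>auto simp: frame_nmem value_cost_def zero_prod_def\<close>)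
  then show ?thesis by (rule wp_mono) (use Q in blast)
qed

lemma wp_cost_com:
  assumes s: "nmem s ''n'' 0 0 = n" "nmem s ''m'' 0 0 = m" "nmem s ''K'' 0 0 = K"
    and N: "n \<le> N" "m \<le> N" "K \<le> N"
    and zero: "\<And>i j. costs s i j = 0" and v: "v = rmem s ''v''"
    and Q: "\<And>s'. frame cost_com s s' \<Longrightarrow>
      (\<And>i j. i < n \<Longrightarrow> j < K \<Longrightarrow> costs s' i j = value_cost v m i (v i j)) \<Longrightarrow> Q s'"
  shows "wp N cost_com Q s"
proof -
  define C where "C i j = value_cost v m i (v i j)" for i j
  \<comment> \<open>Cells not yet reached must be known to be zero, since
    \<open>cost_cell_com\<close> accumulates into them.\<close>
  define I where "I i j s' \<longleftrightarrow> (\<forall>i' j'. costs s' i' j' =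
    (if i' < i \<and> j' < K \<or> i' = i \<and> j' < j then C i' j' else 0))" for i j and s' :: state
  have "wp N cost_com (I n 0) s"
    unfolding cost_com_def
  proof (rule wp_For[where b = n and I = "\<lambda>i. I i 0"], goal_cases)
    case (5 i s')
    show ?case
    proof (rule wp_For[where b = K and I = "\<lambda>j. I i j"], goal_cases)
      case (5 j s'')
      show ?case
      proof (rule wp_cost_cell_com[where m = m and i = i and j = j and v = v], goal_cases)
        case (7 s3)
        then show ?case using 5(1) 7(2) by (simp add: I_def C_def less_Suc_eq)
      qed (use \<open>I i j s''\<close> \<open>nmem s'' _ _ _ = j\<close> \<open>frame _ s' s''\<close> \<open>frame _ s s'\<close> \<open>nmem s' _ _ _ = i\<close>
            s v N in \<open>auto simp: frame_nmem frame_rmem I_def zero_prod_def\<close>)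
    next
      case (6 s'')
      then show ?case by (auto simp: I_def less_Suc_eq)
    qed (use \<open>I i 0 s'\<close> \<open>frame _ s s'\<close> s N in \<open>auto simp: frame_nmem I_def\<close>)
  qed (use s N zero in \<open>auto simp: frame_nmem I_def zero_prod_def\<close>)
  then show ?thesis
    by (rule wp_mono) (use Q in \<open>auto simp: I_def C_def\<close>)
qed

section \<open>Selection of the minimal slack and change of the duals\<close>

abbreviation matching :: "state \<Rightarrow> nat \<Rightarrow> nat" where
  "matching s i \<equiv> nmem s ''M'' i 0"

abbreviation duals :: "state \<Rightarrow> name \<Rightarrow> nat \<Rightarrow> real \<times> real" where
  "duals s x i \<equiv> (rmem s x i 0, rmem s x i 1)"

abbreviation scalar :: "state \<Rightarrow> name \<Rightarrow> nat" where
  "scalar s x \<equiv> nmem s x 0 0"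

locale hungarian = assignment n K C for n K and C :: "nat \<Rightarrow> nat \<Rightarrow> real \<times> real" +
  fixes N :: nat
  assumes K_le_N: "K \<le> N"
begin

definition ready :: "state \<Rightarrow> bool" where
  "ready s \<longleftrightarrow> scalar s ''n'' = n \<and> scalar s ''K'' = K \<and> (\<forall>i<n. \<forall>j<K. costs s i j = C i j)"

lemma ready_frame:
  assumes "ready s" "frame c s s'" "{''n'', ''K''} \<inter> nwrites c = {}" "{''a'', ''b''} \<inter> rwrites c = {}"
  shows "ready s'"
  using assms by (simp add: ready_def frame_nmem frame_rmem)

lemma slack_exp:
  assumes "ready s" "nval a s < n" "nval b s < K"
  shows "(rval (slack_exp ''a'' 0 a b) s, rval (slack_exp ''b'' 1 a b) s) =
    slack (duals s ''u'') (duals s ''w'') (nval a s) (nval b s)"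
proof -
  have "C (nval a s) (nval b s) = costs s (nval a s) (nval b s)"
    using assms by (simp add: ready_def)
  then show ?thesis by (simp add: slack_exp_def slack_def)
qed

lemma bval_slack_less:
  assumes "ready s" "scalar s ''i'' < n" "scalar s ''j'' < K" "scalar s ''bi'' < n" "scalar s ''bj'' < K"
  shows "bval slack_less s \<longleftrightarrow>
    slack (duals s ''u'') (duals s ''w'') (scalar s ''i'') (scalar s ''j'') <
    slack (duals s ''u'') (duals s ''w'') (scalar s ''bi'') (scalar s ''bj'')"
proof -
  have "slack (duals s ''u'') (duals s ''w'') (scalar s ''i'') (scalar s ''j'') =
      (rval (slack_exp ''a'' 0 (Var ''i'') (Var ''j'')) s,
       rval (slack_exp ''b'' 1 (Var ''i'') (Var ''j'')) s)"
    and "slack (duals s ''u'') (duals s ''w'') (scalar s ''bi'') (scalar s ''bj'') =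
      (rval (slack_exp ''a'' 0 (Var ''bi'') (Var ''bj'')) s,
       rval (slack_exp ''b'' 1 (Var ''bi'') (Var ''bj'')) s)"
    using slack_exp[of s "Var ''i''" "Var ''j''"] slack_exp[of s "Var ''bi''" "Var ''bj''"] assms
    by simp_all
  then show ?thesis unfolding slack_less_def by (auto simp del: One_nat_def)
qed

text \<open>\<open>P\<close> is the set of pairs scanned so far, which lets the row loop and the
  column loop share one invariant. Candidates and slacks refer to the state \<open>s\<close> before
  the scan.\<close>

definition best :: "nat \<Rightarrow> state \<Rightarrow> (nat \<Rightarrow> nat \<Rightarrow> bool) \<Rightarrow> state \<Rightarrow> bool" where
  "best k s P s' \<longleftrightarrow> (let cand = candidate k (matching s) (nmem s ''rank'' k);
       sl = slack (duals s ''u'') (duals s ''w''); i = scalar s' ''bi''; j = scalar s' ''bj'' in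
     if scalar s' ''f'' = 0 then \<forall>i' j'. P i' j' \<longrightarrow> \<not> cand i' j'
     else cand i j \<and> (\<forall>i' j'. P i' j' \<longrightarrow> cand i' j' \<longrightarrow> sl i j \<le> sl i' j'))"

text \<open>Only the candidates in \<open>P\<close> matter; thus a row outside the tree counts as
  scanned although its cells are skipped.\<close>

lemma best_cong:
  assumes "best k s P s'" "\<And>i j. candidate k (matching s) (nmem s ''rank'' k) i j \<Longrightarrow> Q i j \<Longrightarrow> P i j"
    "\<And>x. x \<in> {''f'', ''bi'', ''bj''} \<Longrightarrow> scalar s'' x = scalar s' x"
  shows "best k s Q s''"
  using assms(1,3) by (simp add: best_def Let_def split: if_splits) (blast dest: assms(2))+

lemma wp_find_com:
  assumes s: "ready s" "scalar s ''k'' = k" "k < n"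
    and ex: "\<exists>j. candidate k (matching s) (nmem s ''rank'' k) k j"
    and Q: "\<And>s' i j. frame find_com s s' \<Longrightarrow> i = scalar s' ''bi'' \<Longrightarrow> j = scalar s' ''bj'' \<Longrightarrow>
      candidate k (matching s) (nmem s ''rank'' k) i j \<Longrightarrow>
      (\<And>i' j'. candidate k (matching s) (nmem s ''rank'' k) i' j' \<Longrightarrow>
        slack (duals s ''u'') (duals s ''w'') i j \<le> slack (duals s ''u'') (duals s ''w'') i' j') \<Longrightarrow>
      Q s'"
  shows "wp N find_com Q s"
proof -
  have "wp N find_com (best k s (\<lambda>i j. i < Suc k)) s"
    unfolding find_com_def
  proof (rule wp_Seq, rule wp_NStore, rule wp_For[where b = "Suc k" and
        I = "\<lambda>i. best k s (\<lambda>i' j'. i' < i)"], goal_cases)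
    case (5 i s1)
    have i: "scalar s1 ''i'' = i" "i \<le> k" "i < n" using 5 s by auto
    have fr: "scalar s1 ''k'' = k" "scalar s1 ''K'' = K" "nmem s1 ''M'' = nmem s ''M''" "ready s1"
      "nmem s1 ''rank'' = nmem s ''rank''" "rmem s1 = rmem s"
      using 5(4) s by (auto simp: frame_nmem frame_rmem upd_other ready_def fun_eq_iff)
    show ?case
    proof (rule wp_If, goal_cases)
      case 1
      then have r: "0 < nmem s ''rank'' k (matching s i)" using i fr by simp
      show ?case
      proof (rule wp_For[where b = K and I = "\<lambda>j. best k s (\<lambda>i' j'. i' < i \<or> i' = i \<and> j' < j)"],
            goal_cases)
        case (5 j s2)
        have fr2: "scalar s2 ''k'' = k" "scalar s2 ''K'' = K" "nmem s2 ''M'' = nmem s ''M''" "ready s2"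
          "nmem s2 ''rank'' = nmem s ''rank''" "rmem s2 = rmem s" "scalar s2 ''i'' = i"
          using 5(4) i fr by (auto simp: frame_nmem frame_rmem upd_other ready_def fun_eq_iff)
        have j: "scalar s2 ''j'' = j" "j < K" using 5 by auto
        have c: "candidate k (matching s) (nmem s ''rank'' k) i j \<longleftrightarrow> nmem s ''rank'' k j = 0"
          using i j r by (simp add: candidate_def)
        \<comment> \<open>While \<open>f\<close> is zero, \<open>bi\<close> and \<open>bj\<close>
          are stale and may point outside the cost table.\<close>
        have sl: "bval slack_less s2 \<longleftrightarrow> slack (duals s ''u'') (duals s ''w'') i j <
          slack (duals s ''u'') (duals s ''w'') (scalar s2 ''bi'') (scalar s2 ''bj'')"
          if "0 < scalar s2 ''f''"
          using bval_slack_less[of s2] 5(1) that fr2 i j s(3)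
          by (auto simp: best_def Let_def candidate_def)
        \<comment> \<open>Transitivity in a form ready for simplification: whatever the old best
          pair bounds from below, the new pair does too.\<close>
        have better: "\<forall>i' j'. bval slack_less s2 \<longrightarrow> 0 < scalar s2 ''f'' \<longrightarrow>
          slack (duals s ''u'') (duals s ''w'') (scalar s2 ''bi'') (scalar s2 ''bj'') \<le>
            slack (duals s ''u'') (duals s ''w'') i' j' \<longrightarrow>
          slack (duals s ''u'') (duals s ''w'') i j \<le> slack (duals s ''u'') (duals s ''w'') i' j'"
          using sl by (blast intro: less_imp_le less_le_trans)
        show ?case
        proof (rule wp_If, goal_cases)
          case 1
          then show ?case
            using 5(1) c better i j fr2
            by (intro wp_Seq wp_NStore)
              (auto simp: best_def Let_def upd_apply less_Suc_eq split: if_splits)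
        next
          case 2
          then show ?case
            using 5(1) c sl i j fr2
            by (intro wp_Skip)
              (auto simp: best_def Let_def upd_apply less_Suc_eq split: if_splits)
        qed
      next
        case 4
        from 5(1) show ?case by (rule best_cong) (auto simp: upd_apply)
      next
        case (6 s2)
        from 6(1) show ?case
          by (rule best_cong) (auto simp: candidate_def less_Suc_eq upd_apply)
      qed (use fr K_le_N in \<open>auto simp: frame_nmem\<close>)
    next
      case 2
      from 5(1) show ?case
        by (intro wp_Skip, rule best_cong) (use 2 i fr in \<open>auto simp: candidate_def less_Suc_eq upd_apply\<close>)
    qed
  qed (use s n_le_K K_le_N in \<open>auto simp: frame_nmem upd_apply best_def\<close>)
  then show ?thesis
  proof (rule wp_mono)
    fix s' assume b: "best k s (\<lambda>i j. i < Suc k) s'" and f: "frame find_com s s'"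
    have "scalar s' ''f'' \<noteq> 0"
    proof
      assume "scalar s' ''f'' = 0"
      then have "\<not> candidate k (matching s) (nmem s ''rank'' k) k j" for j
        using b by (simp add: best_def)
      then show False using ex by blast
    qed
    then show "Q s'" using b
      by (intro Q[OF f refl refl]) (auto simp: best_def Let_def candidate_def)
  qed
qed

end

text \<open>The function \<open>\<rho>\<close> abstracts the guard, so that one lemma serves rows,
  tested by the rank of their matched column, and columns, tested by their own.\<close>

lemma wp_shift_com:
  assumes y: "y \<noteq> ''d''" and l: "l \<le> N"
    and e: "\<And>s'. frame (shift_com y c x e b) s s' \<Longrightarrow> nval e s' = l"
    and b: "\<And>s'. frame (shift_com y c x e b) s s' \<Longrightarrow> nval b s' = \<rho> (scalar s' x)"
    and Q: "\<And>s'. frame (shift_com y c x e b) s s' \<Longrightarrow>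
      duals s' y = (\<lambda>i. if i < l \<and> 0 < \<rho> i then duals s y i + duals s ''d'' c else duals s y i) \<Longrightarrow>
      Q s'"
  shows "wp N (shift_com y c x e b) Q s"
proof -
  define I where "I k s' \<longleftrightarrow> (\<forall>i. duals s' y i =
    (if i < k \<and> 0 < \<rho> i then duals s y i + duals s ''d'' c else duals s y i))" for k and s' :: state
  have "wp N (shift_com y c x e b) (I l) s"
    unfolding shift_com_def
  proof (rule wp_For[where b = l and I = I], goal_cases)
    case (5 i s1)
    have f: "frame (shift_com y c x e b) s s1" using 5(4) by (simp add: shift_com_def)
    have u: "rmem s1 y j 0 = (if j < i \<and> 0 < \<rho> j then rmem s y j 0 + rmem s ''d'' c 0 else rmem s y j 0)"
      "rmem s1 y j (Suc 0) =
        (if j < i \<and> 0 < \<rho> j then rmem s y j (Suc 0) + rmem s ''d'' c (Suc 0) else rmem s y j (Suc 0))"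
      for j using 5(1)[unfolded I_def, rule_format, of j] by auto
    have "rmem s1 ''d'' = rmem s ''d''" using f y by (simp add: frame_rmem)
    then show ?case
      by (intro wp_If wp_Seq wp_RStore wp_Skip)
        (use 5(2,3) u b[OF f] y in \<open>auto simp: I_def upd_apply less_Suc_eq\<close>)
  qed (use l e in \<open>auto simp: I_def shift_com_def\<close>)
  then show ?thesis
    by (rule wp_mono) (rule Q, auto simp: I_def)
qed

context hungarian begin

lemma wp_dual_com:
  assumes s: "ready s" "scalar s ''k'' = k" "k < n"
    and ij: "scalar s ''bi'' = i" "i < n" "scalar s ''bj'' = j" "j < K"
  defines "d \<equiv> slack (duals s ''u'') (duals s ''w'') i j" and "rank \<equiv> nmem s ''rank'' k"
  assumes Q: "\<And>s'. frame dual_com s s' \<Longrightarrow>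
      duals s' ''u'' = (\<lambda>x. if x \<le> k \<and> 0 < rank (matching s x)
        then duals s ''u'' x + d else duals s ''u'' x) \<Longrightarrow>
      duals s' ''w'' = (\<lambda>x. if x < K \<and> 0 < rank x
        then duals s ''w'' x - d else duals s ''w'' x) \<Longrightarrow> Q s'"
  shows "wp N dual_com Q s"
proof -
  define d0 d1 where "d0 = rval (slack_exp ''a'' 0 (Var ''bi'') (Var ''bj'')) s"
    and "d1 = rval (slack_exp ''b'' 1 (Var ''bi'') (Var ''bj'')) s"
  have d: "d = (d0, d1)"
    using slack_exp[of s "Var ''bi''" "Var ''bj''"] s ij by (simp add: d_def d0_def d1_def)
  have sl: "rval (slack_exp ''b'' 1 (Var ''bi'') (Var ''bj''))
      (s\<lparr>rmem := upd (rmem s) ''d'' 0 0 z\<rparr>) = d1" for z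
    by (simp add: d1_def slack_exp_def upd_other)
  \<comment> \<open>The slack is saved in \<open>d\<close> with both signs before any shift, since
    the shift of \<open>u\<close> already alters the slack of \<open>(i, j)\<close>.\<close>
  define s0 where "s0 = s\<lparr>rmem := upd (upd (upd (upd (rmem s) ''d'' 0 0 d0) ''d'' 0 1 d1)
    ''d'' 1 0 (- d0)) ''d'' 1 1 (- d1)\<rparr>"
  have s0: "nmem s0 = nmem s" "rmem s0 ''w'' = rmem s ''w''" "rmem s0 ''u'' = rmem s ''u''"
    "duals s0 ''d'' 0 = d" "duals s0 ''d'' 1 = - d"
    by (auto simp: s0_def upd_other upd_apply d)
  have "wp N (shift_com ''u'' 0 ''i'' (NAdd (Var ''k'') (NConst 1))
         (NLoad ''rank'' (Var ''k'') (At ''M'' (Var ''i''))))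
      (wp N (shift_com ''w'' 1 ''j'' (Var ''K'') (NLoad ''rank'' (Var ''k'') (Var ''j'')))
      (\<lambda>s'. duals s' ''u'' = (\<lambda>x. if x \<le> k \<and> 0 < rank (matching s x)
        then duals s ''u'' x + d else duals s ''u'' x) \<and>
      duals s' ''w'' = (\<lambda>x. if x < K \<and> 0 < rank x
        then duals s ''w'' x - d else duals s ''w'' x))) s0"
  proof (rule wp_shift_com[where l = "Suc k" and \<rho> = "\<lambda>x. rank (matching s x)"], goal_cases)
    case (5 s1)
    then have u: "duals s1 ''u'' = (\<lambda>x. if x \<le> k \<and> 0 < rank (matching s x)
        then duals s ''u'' x + d else duals s ''u'' x)" by (simp only: s0 less_Suc_eq_le)
    have s1: "rmem s1 ''w'' = rmem s ''w''" "duals s1 ''d'' 1 = - d" "scalar s1 ''K'' = K"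
      "scalar s1 ''k'' = k" "nmem s1 ''rank'' k = rank"
      using 5(1) s0 s by (simp_all add: frame_nmem frame_rmem rank_def ready_def)
    show ?case
    proof (rule wp_shift_com[where l = K and \<rho> = rank], goal_cases)
      case (5 s2)
      then have "duals s2 ''w'' = (\<lambda>x. if x < K \<and> 0 < rank x
        then duals s ''w'' x - d else duals s ''w'' x)" by (simp only: s1 diff_conv_add_uminus)
      moreover have "rmem s2 ''u'' = rmem s1 ''u''" using 5(1) by (simp add: frame_rmem)
      ultimately show ?case using u by simp
    qed (use K_le_N s1 in \<open>auto simp: frame_nmem\<close>)
  qed (use s s0 n_le_K K_le_N in \<open>auto simp: frame_nmem rank_def\<close>)
  then have "wp N dual_com (\<lambda>s'. duals s' ''u'' = (\<lambda>x. if x \<le> k \<and> 0 < rank (matching s x)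
        then duals s ''u'' x + d else duals s ''u'' x) \<and>
      duals s' ''w'' = (\<lambda>x. if x < K \<and> 0 < rank x
        then duals s ''w'' x - d else duals s ''w'' x)) s"
    unfolding dual_com_def
    by (intro wp_Seq wp_RStore) (simp add: sl[simplified] s0_def upd_apply flip: d0_def)
  then show ?thesis by (rule wp_mono) (use Q in blast)
qed

section \<open>One phase: search and augmentation\<close>

definition occupied :: "nat set \<Rightarrow> state \<Rightarrow> bool" where
  "occupied X s \<longleftrightarrow> (\<forall>j\<le>K. 0 < nmem s ''occ'' j 0 \<longleftrightarrow> j = K \<or> j \<in> X)"

abbreviation searching_state :: "nat \<Rightarrow> state \<Rightarrow> bool" where
  "searching_state k s \<equiv> searching k (matching s) (duals s ''u'') (duals s ''w'')
     (nmem s ''rank'' k) (nmem s ''parent'' k) (scalar s ''r'') (scalar s ''j0'')"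

text \<open>The other rows of \<open>rank\<close> are mentioned explicitly because
  \<open>frame\<close> speaks of whole arrays only; later phases rely on their rows being
  zero.\<close>

lemma wp_search_com:
  assumes s: "ready s" "scalar s ''k'' = k" "k < n"
    and S: "searching_state k s" and occ: "occupied (matching s ` {..<k}) s"
    and Q: "\<And>s'. frame search_com s s' \<Longrightarrow> searching_state k s' \<Longrightarrow>
      (\<And>k'. k' \<noteq> k \<Longrightarrow> nmem s' ''rank'' k' = nmem s ''rank'' k') \<Longrightarrow>
      scalar s' ''j0'' \<noteq> K \<Longrightarrow> scalar s' ''j0'' \<notin> matching s ` {..<k} \<Longrightarrow> Q s'"
  shows "wp N search_com Q s"
proof -
  have "wp N search_com (\<lambda>s'. searching_state k s' \<and>
    (\<forall>k'. k' \<noteq> k \<longrightarrow> nmem s' ''rank'' k' = nmem s ''rank'' k') \<and>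
    scalar s' ''j0'' \<noteq> K \<and> scalar s' ''j0'' \<notin> matching s ` {..<k}) s"
    unfolding search_com_def
  proof (rule wp_While[where I = "\<lambda>s'. searching_state k s' \<and>
        (\<forall>k'. k' \<noteq> k \<longrightarrow> nmem s' ''rank'' k' = nmem s ''rank'' k')"
        and \<mu> = "\<lambda>s'. Suc K - scalar s' ''r''"], goal_cases)
    case (3 s1)
    have s1: "ready s1" "scalar s1 ''k'' = k" "nmem s1 ''M'' = nmem s ''M''"
      "nmem s1 ''occ'' = nmem s ''occ''"
      using 3(2) s by (auto simp: frame_nmem frame_rmem ready_def)
    have S1: "searching_state k s1" using 3(1) by blast
    have j0: "scalar s1 ''j0'' = K \<or> scalar s1 ''j0'' \<in> matching s1 ` {..<k}"
      using 3(3) S1 occ s1 by (auto simp: occupied_def searching_def)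
    show ?case
    proof (rule wp_Seq, rule wp_find_com, fact, fact, fact, goal_cases)
      case 1
      show ?case by (rule candidate_exists[OF S1 j0])
    next
      case (2 s2 i j)
      have s2: "ready s2" "scalar s2 ''k'' = k" "nmem s2 ''M'' = nmem s1 ''M''"
        "nmem s2 ''rank'' = nmem s1 ''rank''" "nmem s2 ''parent'' = nmem s1 ''parent''"
        "scalar s2 ''r'' = scalar s1 ''r''" "rmem s2 = rmem s1"
        using 2(1) s1 by (auto simp: frame_nmem frame_rmem ready_def fun_eq_iff)
      have ij: "i < n" "j < K" using 2(4) s(3) by (auto simp: candidate_def)
      show ?case
      proof (rule wp_Seq, rule wp_dual_com[where k = k and i = i and j = j], goal_cases)
        case (8 s3)
        have s3: "scalar s3 ''k'' = k" "nmem s3 ''M'' = nmem s1 ''M''"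
          "nmem s3 ''rank'' = nmem s1 ''rank''" "nmem s3 ''parent'' = nmem s1 ''parent''"
          "scalar s3 ''r'' = scalar s1 ''r''" "scalar s3 ''bi'' = i" "scalar s3 ''bj'' = j"
          using 8(1) s2 2(2,3) by (auto simp: frame_nmem)
        have step: "searching k (matching s1) (duals s3 ''u'') (duals s3 ''w'')
          ((nmem s1 ''rank'' k)(j := Suc (scalar s1 ''r''))) ((nmem s1 ''parent'' k)(j := i))
          (Suc (scalar s1 ''r'')) j"
          using searching_step[OF S1 j0 2(4) 2(5)] unfolding 8(2,3) s2 by simp
        \<comment> \<open>Subtraction is truncated, so the decrease needs \<open>r \<le> K\<close>;
          the cardinality equation after the step yields it.\<close>
        have "K - scalar s1 ''r'' < Suc K - scalar s1 ''r''"
          using step by (auto simp: searching_def)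
        then show ?case
          using step 3(1) s3 by (intro wp_Seq wp_NStore) (simp add: upd_row)
      qed (use s s2 2 ij in auto)
    qed
  next
    case (4 s1)
    have "nmem s1 ''occ'' = nmem s ''occ''" "scalar s1 ''j0'' \<le> K"
      using 4(1,2) s by (auto simp: frame_nmem searching_def)
    then show ?case using 4 occ by (auto simp: occupied_def)
  qed (use S K_le_N in auto)
  then show ?thesis by (rule wp_mono) (use Q in auto)
qed

abbreviation optimal_state :: "nat \<Rightarrow> state \<Rightarrow> bool" where
  "optimal_state k s \<equiv> optimal k (matching s) (duals s ''u'') (duals s ''w'') \<and>
     occupied (matching s ` {..<k}) s"

lemma wp_augment_com:
  assumes s: "ready s" "scalar s ''k'' = k" "k < n"
    and S: "searching_state k s" and occ: "occupied (matching s ` {..<k}) s"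
    and j0: "scalar s ''j0'' \<noteq> K" "scalar s ''j0'' \<notin> matching s ` {..<k}"
    and Q: "\<And>s'. frame augment_com s s' \<Longrightarrow> optimal_state (Suc k) s' \<Longrightarrow> Q s'"
  shows "wp N augment_com Q s"
proof -
  define s0 where "s0 = s\<lparr>nmem := upd (nmem s) ''occ'' (scalar s ''j0'') 0 1\<rparr>"
  define aug where "aug s' = augmenting k (matching s') (duals s ''u'') (duals s ''w'')
     (nmem s ''rank'' k) (nmem s ''parent'' k) (scalar s' ''j0'')" for s'
  let ?set = "\<lambda>s'. insert (scalar s' ''j0'') (matching s' ` {..k})"
  have s0: "nmem s0 x = nmem s x" if "x \<noteq> ''occ''" for x
    using that by (simp add: s0_def upd_other)
  have r0: "rmem s0 = rmem s" by (simp add: s0_def)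
  have j0K: "scalar s ''j0'' \<le> K" and Mk: "matching s k = K"
    and rank: "nmem s ''rank'' k (scalar s ''j0'') \<le> Suc K"
    using S by (auto simp: searching_def)
  have "wp N augment_com (\<lambda>s'. optimal_state (Suc k) s') s"
    unfolding augment_com_def
  \<comment> \<open>The array \<open>occ\<close> describes matched columns and hole together, a set
    that the loop preserves. The measure is the rank of the hole.\<close>
  proof (rule wp_Seq, rule wp_NStore, unfold nval.simps, fold s0_def,
      rule wp_While[where I = "\<lambda>s'. aug s' \<and> occupied (?set s') s'"
        and \<mu> = "\<lambda>s'. nmem s ''rank'' k (scalar s' ''j0'')"], goal_cases)
    case 1
    have "aug s0" using augmenting_start[OF S j0] by (simp add: aug_def s0)
    moreover have "matching s ` {..k} = insert K (matching s ` {..<k})"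
      using Mk by (simp add: ivl_disj_un_singleton(2)[symmetric])
    ultimately show ?case using occ j0K s0 by (auto simp: occupied_def s0_def upd_apply)
  next
    case 2
    show ?case using rank K_le_N s0 by simp
  next
    case (3 s1)
    define j i where "j = scalar s1 ''j0''" and "i = nmem s ''parent'' k j"
    have s1: "scalar s1 ''k'' = k" "scalar s1 ''K'' = K" "nmem s1 ''parent'' = nmem s ''parent''"
      using 3(2) s s0 by (auto simp: frame_nmem ready_def)
    have jK: "j \<noteq> K" using 3(3) s1 by (simp add: j_def)
    have A: "augmenting k (matching s1) (duals s ''u'') (duals s ''w'')
     (nmem s ''rank'' k) (nmem s ''parent'' k) j" using 3(1) by (simp add: aug_def j_def)
    define s2 where "s2 = s1\<lparr>nmem := upd (upd (upd (upd (nmem s1) ''i'' 0 0 i) ''h'' 0 0 (matching s1 i))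
      ''M'' i 0 j) ''j0'' 0 0 (matching s1 i)\<rparr>"
    have s2: "matching s2 = (matching s1)(i := j)" "scalar s2 ''j0'' = matching s1 i"
      "nmem s2 ''occ'' = nmem s1 ''occ''"
      by (auto simp: s2_def upd_apply upd_other)
    have "aug s2" using augmenting_step(1)[OF A jK] s2 by (simp add: aug_def i_def)
    moreover have "?set s2 = ?set s1"
      using augmenting_step(3)[OF A jK] unfolding s2 j_def[symmetric] i_def .
    moreover have "nmem s ''rank'' k (matching s1 i) < nmem s ''rank'' k j"
      using augmenting_step(2)[OF A jK] by (simp add: i_def)
    ultimately have "(aug s2 \<and> occupied (?set s2) s2) \<and>
      nmem s ''rank'' k (scalar s2 ''j0'') < nmem s ''rank'' k (scalar s1 ''j0'')"
      using 3(1) s2(2,3) by (simp add: occupied_def j_def)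
    then show ?case
      by (intro wp_Seq wp_NStore)
        (use s1 in \<open>simp add: upd_apply s2_def flip: j_def i_def\<close>)
  next
    case (4 s1)
    have s1: "scalar s1 ''K'' = K" "rmem s1 = rmem s"
      using 4(2) s s0 r0 by (auto simp: frame_nmem frame_rmem ready_def fun_eq_iff)
    have "scalar s1 ''j0'' \<le> K" using 4(1) by (simp add: aug_def augmenting_def)
    then have j0: "scalar s1 ''j0'' = K" using 4(3) s1 by simp
    then have "optimal (Suc k) (matching s1) (duals s1 ''u'') (duals s1 ''w'')"
      using 4(1) unfolding s1(2) aug_def j0 by (blast intro: augmenting_end)
    then show ?case using 4(1) j0 by (auto simp: occupied_def lessThan_Suc_atMost)
  qed
  then show ?thesis by (rule wp_mono) (use Q in auto)
qed

lemma wp_phase_com: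
  assumes s: "ready s" "scalar s ''k'' = k" "k < n"
    and opt: "optimal_state k s" and rank: "\<And>k' j. k \<le> k' \<Longrightarrow> nmem s ''rank'' k' j = 0"
    and Q: "\<And>s'. frame phase_com s s' \<Longrightarrow> optimal_state (Suc k) s' \<Longrightarrow>
      (\<And>k' j. Suc k \<le> k' \<Longrightarrow> nmem s' ''rank'' k' j = 0) \<Longrightarrow> Q s'"
  shows "wp N phase_com Q s"
proof -
  define s0 where "s0 = s\<lparr>nmem := upd (upd (upd (upd (nmem s) ''M'' k 0 K) ''rank'' k K 1)
    ''r'' 0 0 1) ''j0'' 0 0 K\<rparr>"
  have s0: "matching s0 = (matching s)(k := K)" "nmem s0 ''rank'' k = (nmem s ''rank'' k)(K := 1)"
    "scalar s0 ''r'' = 1" "scalar s0 ''j0'' = K" "rmem s0 = rmem s" "nmem s0 ''occ'' = nmem s ''occ''"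
    "ready s0" "scalar s0 ''k'' = k" "\<And>k'. k' \<noteq> k \<Longrightarrow> nmem s0 ''rank'' k' = nmem s ''rank'' k'"
    using s by (auto simp: s0_def upd_row upd_other ready_def)
  have S: "searching_state k s0"
    unfolding s0 using searching_start[of k "matching s"] opt s(3) rank by simp
  have occ: "occupied (matching s0 ` {..<k}) s0"
  proof -
    have "matching s0 ` {..<k} = matching s ` {..<k}" unfolding s0(1) by auto
    then show ?thesis using opt s0(6) by (simp add: occupied_def)
  qed
  have "wp N search_com (wp N augment_com (\<lambda>s'. optimal_state (Suc k) s' \<and>
      (\<forall>k' j. Suc k \<le> k' \<longrightarrow> nmem s' ''rank'' k' j = 0))) s0"
  proof (rule wp_search_com[OF s0(7,8) s(3) S occ], goal_cases)
    case (1 s1)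
    have s1: "ready s1" "scalar s1 ''k'' = k" "nmem s1 ''M'' = nmem s0 ''M''"
      "nmem s1 ''occ'' = nmem s0 ''occ''"
      using 1(1) s0 by (auto simp: frame_nmem frame_rmem ready_def)
    show ?case
    proof (rule wp_augment_com[OF s1(1,2) s(3) 1(2)], goal_cases)
      case (4 s2)
      have "nmem s2 ''rank'' = nmem s1 ''rank''" using 4(1) by (simp add: frame_nmem)
      then show ?case using 4(2) 1(3) s0(9) rank by simp
    qed (use occ 1 s1 in \<open>auto simp: occupied_def\<close>)
  qed
  then have "wp N phase_com (\<lambda>s'. optimal_state (Suc k) s' \<and>
      (\<forall>k' j. Suc k \<le> k' \<longrightarrow> nmem s' ''rank'' k' j = 0)) s"
    unfolding phase_com_def
    by (intro wp_Seq wp_NStore) (use s in \<open>simp add: s0_def upd_apply ready_def\<close>)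
  then show ?thesis by (rule wp_mono) (use Q in auto)
qed

end

section \<open>Output and the complete program\<close>

lemma wp_output_com:
  assumes s: "scalar s ''n'' = n" "scalar s ''m'' = m" "n \<le> N" "\<And>i. nmem s ''out'' i 0 = 0"
    and Q: "\<And>s'. output_allocation n s' =
      (\<lambda>i. if i < n \<and> matching s i < m then Some (matching s i) else None) \<Longrightarrow> Q s'"
  shows "wp N output_com Q s"
proof -
  have "wp N output_com (\<lambda>s'. \<forall>i. nmem s' ''out'' i 0 =
      (if i < n \<and> matching s i < m then Suc (matching s i) else 0)) s"
    unfolding output_com_def
  proof (rule wp_For[where b = n and I = "\<lambda>k s'. \<forall>i. nmem s' ''out'' i 0 =
      (if i < k \<and> matching s i < m then Suc (matching s i) else 0)"], goal_cases)
    case (5 i s1)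
    have "nmem s1 ''M'' = nmem s ''M''" "scalar s1 ''m'' = m"
      using 5(4) s by (auto simp: frame_nmem)
    then show ?case
      by (intro wp_If wp_NStore wp_Skip)
        (use 5(1-3) in \<open>auto simp: upd_apply less_Suc_eq\<close>)
  qed (use s in \<open>auto simp: frame_nmem upd_apply\<close>)
  then show ?thesis
    by (rule wp_mono) (rule Q, auto simp: output_allocation_def fun_eq_iff)
qed

lemma (in hungarian) wp_phases:
  assumes s: "ready s" and opt: "optimal_state 0 s" and rank: "\<And>k j. nmem s ''rank'' k j = 0"
    and Q: "\<And>s'. frame (For ''k'' (Var ''n'') phase_com) s s' \<Longrightarrow> optimal_state n s' \<Longrightarrow> Q s'"
  shows "wp N (For ''k'' (Var ''n'') phase_com) Q s"
proof (rule wp_For[where b = n and I = "\<lambda>k s'. optimal_state k s' \<and>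
      (\<forall>k' j. k \<le> k' \<longrightarrow> nmem s' ''rank'' k' j = 0)"], goal_cases)
  case (5 k s1)
  have "ready s1" using s 5(4) by (rule ready_frame) auto
  then show ?case
    by (rule wp_phase_com[where k = k]) (use 5 in \<open>auto simp: upd_other occupied_def\<close>)
qed (use s opt rank n_le_K K_le_N Q in \<open>auto simp: frame_nmem ready_def upd_other occupied_def\<close>)

text \<open>\<open>x\<close> is zero or one of the nonnegative summands from which it is subtracted.
  This is what makes zero duals feasible.\<close>

lemma value_cost_nonneg:
  assumes "\<And>h. h < m \<Longrightarrow> 0 \<le> v i h" and "x = 0 \<or> (\<exists>h<m. x = v i h)"
  shows "0 \<le> value_cost v m i x"
proof -
  have "x \<le> (\<Sum>h<m. v i h)"
    using assms by (auto intro!: sum_nonneg member_le_sum)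
  moreover have "0 \<le> (\<Sum>h<m. max (v i h - x) 0)" by (intro sum_nonneg) simp
  ultimately show ?thesis by (auto simp: value_cost_def less_eq_prod_def)
qed

lemma wp_house_com:
  assumes v: "\<And>i h. i < n \<Longrightarrow> h < m \<Longrightarrow> 0 \<le> v i h"
  defines "v' \<equiv> \<lambda>i h. if i < n \<and> h < m then v i h else 0"
  shows "wp (n + m) house_com (\<lambda>s'. \<exists>M. inj_on M {..<n} \<and> M ` {..<n} \<subseteq> {..<n + m} \<and>
      (\<forall>B. inj_on B {..<n} \<longrightarrow> B ` {..<n} \<subseteq> {..<n + m} \<longrightarrow>
        (\<Sum>i<n. value_cost v' m i (v' i (M i))) \<le> (\<Sum>i<n. value_cost v' m i (v' i (B i)))) \<and>
      output_allocation n s' = (\<lambda>i. if i < n \<and> M i < m then Some (M i) else None))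
    (input_state n m v)"
proof -
  define C where "C i j = value_cost v' m i (v' i j)" for i j
  interpret hungarian n "n + m" C "n + m" by unfold_locales auto
  have C: "0 \<le> C i j" for i j
    unfolding C_def by (rule value_cost_nonneg) (use v in \<open>auto simp: v'_def\<close>)
  define s0 where "s0 = setn (input_state n m v) ''K'' (n + m)"
  have s0: "scalar s0 ''n'' = n" "scalar s0 ''m'' = m" "scalar s0 ''K'' = n + m"
    "nmem s0 x = (\<lambda>_ _. 0)" "rmem s0 ''v'' = v'" "rmem s0 y = (\<lambda>_ _. 0)"
    if "x \<notin> {''n'', ''m'', ''K''}" "y \<noteq> ''v''" for x y
    using that by (auto simp: s0_def input_state_def upd_apply upd_other v'_def fun_eq_iff)
  \<comment> \<open>The pairing is arbitrary: each instance supplies one array of naturals and one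
    of reals.\<close>
  note s0 = s0[of "''M''" "''u''"] s0[of "''occ''" "''w''"] s0[of "''rank''" "''a''"]
    s0[of "''out''" "''b''"]
  show ?thesis
    unfolding house_com_def
  proof (rule wp_Seq, rule wp_NStore, goal_cases)
    case 1
    have "wp (n + m) (Seq cost_com (Seq (NStore ''occ'' (Var ''K'') (NConst 0) (NConst 1))
     (Seq (For ''k'' (Var ''n'') phase_com) output_com)))
     (\<lambda>s'. \<exists>M. inj_on M {..<n} \<and> M ` {..<n} \<subseteq> {..<n + m} \<and>
      (\<forall>B. inj_on B {..<n} \<longrightarrow> B ` {..<n} \<subseteq> {..<n + m} \<longrightarrow>
        (\<Sum>i<n. C i (M i)) \<le> (\<Sum>i<n. C i (B i))) \<and>
      output_allocation n s' = (\<lambda>i. if i < n \<and> M i < m then Some (M i) else None)) s0"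
    proof (rule wp_Seq, rule wp_cost_com[where n = n and m = m and K = "n + m" and v = v'], goal_cases)
      case (9 s1)
      have s1: "ready s1" "scalar s1 ''m'' = m" "scalar s1 ''K'' = n + m"
        "nmem s1 ''M'' = (\<lambda>_ _. 0)" "nmem s1 ''occ'' = (\<lambda>_ _. 0)" "nmem s1 ''out'' = (\<lambda>_ _. 0)"
        "nmem s1 ''rank'' = (\<lambda>_ _. 0)" "rmem s1 ''u'' = (\<lambda>_ _. 0)" "rmem s1 ''w'' = (\<lambda>_ _. 0)"
        using 9 s0 by (auto simp: frame_nmem frame_rmem ready_def C_def)
      define s2 where "s2 = s1\<lparr>nmem := upd (nmem s1) ''occ'' (n + m) 0 1\<rparr>"
      have "ready s2" using s1 by (simp add: s2_def ready_def upd_other)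
      have "feasible (duals s2 ''u'') (duals s2 ''w'')"
        using C s1 by (auto simp: feasible_def s2_def zero_prod_def[symmetric])
      then have opt: "optimal_state 0 s2"
        using s1 by (auto simp: optimal_def s2_def occupied_def upd_apply zero_prod_def)
      show ?case
      proof (rule wp_Seq, rule wp_NStore, simp only: nval.simps s1, fold s2_def, rule wp_Seq,
          rule wp_phases[OF \<open>ready s2\<close> opt], goal_cases)
        case 1
        show ?case using s1 by (simp add: s2_def upd_other)
      next
        case (2 s3)
        have s3: "scalar s3 ''n'' = n" "scalar s3 ''m'' = m" "nmem s3 ''out'' = (\<lambda>_ _. 0)"
          using 2(1) s1 by (auto simp: frame_nmem s2_def upd_other ready_def)
        have M: "optimal n (matching s3) (duals s3 ''u'') (duals s3 ''w'')" using 2(2) by blast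
        show ?case
          by (rule wp_output_com[where n = n and m = m], use s3 in \<open>simp_all\<close>)
            (rule exI[of _ "matching s3"],
              use M optimal_sum_le[OF M] in \<open>auto simp: optimal_def\<close>)
      qed
    qed (use s0 in \<open>auto simp: zero_prod_def\<close>)
    then show ?case
      by (simp add: C_def s0_def input_state_def upd_apply)
  qed
qed

section \<open>Envy of welfare-maximal allocations\<close>

definition house_envy :: "'a set \<Rightarrow> 'h set \<Rightarrow> ('a \<Rightarrow> 'h \<Rightarrow> real) \<Rightarrow> ('a \<rightharpoonup> 'h) \<Rightarrow> real" where
  "house_envy N H v A = (\<Sum>i\<in>N. \<Sum>h\<in>H. max (v i h - bundle_value (v i) (A i)) 0)"

lemma bundle_value_nonneg:
  assumes "house_instance N H v" "allocation N H A" "i \<in> N"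
  shows "0 \<le> bundle_value (v i) (A i)"
  using assms by (cases "A i") (auto simp: house_instance_def allocation_def ran_def)

lemma unassigned_house_value_le:
  assumes inst: "house_instance N H v" and A: "is_arg_max (usw N v) (allocation N H) A"
    and i: "i \<in> N" and h: "h \<in> H" "h \<notin> ran A"
  shows "v i h \<le> bundle_value (v i) (A i)"
proof -
  have fin: "finite N" and alloc: "allocation N H A"
    using inst A by (auto simp: house_instance_def is_arg_max_def)
  have "allocation N H (A(i \<mapsto> h))"
    using alloc i h by (auto simp: allocation_def inj_on_def ran_def)
  then have "\<not> usw N v A < usw N v (A(i \<mapsto> h))"
    using A by (auto simp: is_arg_max_def)
  moreover have "usw N v (A(i \<mapsto> h)) =
      v i h + (\<Sum>j\<in>N - {i}. bundle_value (v j) (A j))"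
    unfolding usw_def using fin i by (subst sum.remove[of N i]) auto
  moreover have "usw N v A = bundle_value (v i) (A i) + (\<Sum>j\<in>N - {i}. bundle_value (v j) (A j))"
    unfolding usw_def using fin i by (subst sum.remove[of N i]) auto
  ultimately show ?thesis by simp
qed

text \<open>Agents without a house contribute nothing because bundle values are nonnegative,
  unassigned houses contribute nothing because welfare is maximal, and injectivity of
  \<open>A\<close> matches the remaining summands.\<close>

lemma total_envy_eq_house_envy:
  assumes inst: "house_instance N H v" and A: "is_arg_max (usw N v) (allocation N H) A"
  shows "total_envy N v A = house_envy N H v A"
  unfolding total_envy_def house_envy_def
proof (rule sum.cong[OF refl])
  fix i assume i: "i \<in> N"
  have fin: "finite N" "finite H" and alloc: "allocation N H A"
    using inst A by (auto simp: house_instance_def is_arg_max_def)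
  define x where "x = bundle_value (v i) (A i)"
  have x: "0 \<le> x" unfolding x_def by (rule bundle_value_nonneg[OF inst alloc i])
  have dom: "dom A \<subseteq> N" and ran: "ran A \<subseteq> H" and inj: "inj_on (\<lambda>j. the (A j)) (dom A)"
    using alloc by (auto simp: allocation_def inj_on_def dom_def)
  have im: "(\<lambda>j. the (A j)) ` dom A = ran A" by (force simp: ran_def dom_def)
  have "(\<Sum>j\<in>N. max (bundle_value (v i) (A j) - x) 0) =
      (\<Sum>j\<in>dom A. max (bundle_value (v i) (A j) - x) 0)"
    using fin dom x by (intro sum.mono_neutral_right) (auto simp: domIff)
  also have "\<dots> = (\<Sum>j\<in>dom A. max (v i (the (A j)) - x) 0)"
    by (intro sum.cong) auto
  also have "\<dots> = (\<Sum>h\<in>ran A. max (v i h - x) 0)"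
    using sum.reindex[OF inj, of "\<lambda>h. max (v i h - x) 0"] by (simp add: im)
  also have "\<dots> = (\<Sum>h\<in>H. max (v i h - x) 0)"
    using fin ran unassigned_house_value_le[OF inst A i]
    by (intro sum.mono_neutral_left) (auto simp: x_def)
  finally show "(\<Sum>j\<in>N. max (bundle_value (v i) (A j) - bundle_value (v i) (A i)) 0) =
      (\<Sum>h\<in>H. max (v i h - bundle_value (v i) (A i)) 0)"
    by (simp add: x_def)
qed

text \<open>The first cost component is a constant minus the welfare. Where it ties, both
  allocations have maximum welfare, and only there \<open>house_envy\<close> is replaced by the true
  envy.\<close>

lemma house_matching_optimal:
  fixes v :: "nat \<Rightarrow> nat \<Rightarrow> real"
  assumes inst: "house_instance {..<n} {..<m} v"
    and inj: "inj_on M {..<n}"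
  defines "v' \<equiv> \<lambda>i h. if i < n \<and> h < m then v i h else 0"
  assumes opt: "\<And>B. inj_on B {..<n} \<Longrightarrow> B ` {..<n} \<subseteq> {..<n + m} \<Longrightarrow>
      (\<Sum>i<n. value_cost v' m i (v' i (M i))) \<le> (\<Sum>i<n. value_cost v' m i (v' i (B i)))"
  shows "is_arg_min (total_envy {..<n} v) (is_arg_max (usw {..<n} v) (allocation {..<n} {..<m}))
    (\<lambda>i. if i < n \<and> M i < m then Some (M i) else None)"
    (is "is_arg_min _ ?max ?A")
proof -
  let ?envy = "house_envy {..<n} {..<m} v"
  define V where "V = (\<Sum>i<n. \<Sum>h<m. v i h)"
  have cost: "(\<Sum>i<n. value_cost v' m i (x i)) = (V - usw {..<n} v A, ?envy A)"
    if "\<And>i. i < n \<Longrightarrow> x i = bundle_value (v i) (A i)" for x A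
    using that by (simp add: value_cost_def sum_prod V_def v'_def usw_def house_envy_def sum_subtractf)
  have "(V - usw {..<n} v ?A, ?envy ?A) \<le> (V - usw {..<n} v A, ?envy A)"
    if A: "allocation {..<n} {..<m} A" for A
  proof -
    \<comment> \<open>An agent \<open>i\<close> without a house takes its own dummy column
      \<open>m + i\<close>; this keeps \<open>B\<close> injective and explains the number of
      dummies.\<close>
    define B where "B i = (case A i of None \<Rightarrow> m + i | Some h \<Rightarrow> h)" for i
    have ran: "h < m" if "A i = Some h" for i h
      using A that by (auto simp: allocation_def ran_def)
    have "inj_on B {..<n}"
    proof (rule inj_onI)
      fix i j assume "B i = B j"
      moreover have "i = j" if "A i = Some h" "A j = Some h" for h
        using A that by (auto simp: allocation_def inj_on_def dom_def)
      ultimately show "i = j" using ran by (fastforce simp: B_def split: option.splits)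
    qed
    moreover have "B ` {..<n} \<subseteq> {..<n + m}"
      using ran by (force simp: B_def split: option.splits)
    ultimately have "(\<Sum>i<n. value_cost v' m i (v' i (M i))) \<le> (\<Sum>i<n. value_cost v' m i (v' i (B i)))"
      by (rule opt)
    moreover have "(\<Sum>i<n. value_cost v' m i (v' i (B i))) = (V - usw {..<n} v A, ?envy A)"
      using ran by (intro cost) (auto simp: B_def v'_def split: option.split)
    moreover have "(\<Sum>i<n. value_cost v' m i (v' i (M i))) = (V - usw {..<n} v ?A, ?envy ?A)"
      by (intro cost) (simp add: v'_def)
    ultimately show ?thesis by simp
  qed
  then have best: "usw {..<n} v A \<le> usw {..<n} v ?A"
      "usw {..<n} v ?A \<le> usw {..<n} v A \<Longrightarrow> ?envy ?A \<le> ?envy A"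
    if "allocation {..<n} {..<m} A" for A using that by force+
  have "allocation {..<n} {..<m} ?A"
    using inj by (auto simp: allocation_def inj_on_def ran_def split: if_splits)
  then have max: "?max ?A" using best(1) by (auto simp: is_arg_max_def not_less)
  moreover have "\<not> total_envy {..<n} v A < total_envy {..<n} v ?A" if "?max A" for A
  proof -
    have "?envy ?A \<le> ?envy A"
      using that max best(2)[of A] by (auto simp: is_arg_max_def not_less)
    then show ?thesis
      using total_envy_eq_house_envy[OF inst that] total_envy_eq_house_envy[OF inst max] by simp
  qed
  ultimately show ?thesis by (auto simp: is_arg_min_def)
qed

theorem theorem4p3:
  "\<exists>(c :: com) (p :: nat poly). \<forall>(n :: nat) (m :: nat) (v :: nat \<Rightarrow> nat \<Rightarrow> real).
     house_instance {..<n} {..<m} v \<longrightarrow>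
     (\<exists>t s. exec c (input_state n m v) t s \<and> t \<le> poly p (n + m) \<and>
        is_arg_min (total_envy {..<n} v)
          (is_arg_max (usw {..<n} v) (allocation {..<n} {..<m}))
          (output_allocation n s))"
proof (intro exI[of _ house_com] exI[of _ "time_poly house_com"] allI impI)
  fix n m :: nat and v :: "nat \<Rightarrow> nat \<Rightarrow> real"
  assume inst: "house_instance {..<n} {..<m} v"
  have "wp (n + m) house_com (\<lambda>s. is_arg_min (total_envy {..<n} v)
      (is_arg_max (usw {..<n} v) (allocation {..<n} {..<m})) (output_allocation n s))
    (input_state n m v)"
  proof (rule wp_mono, rule wp_house_com, goal_cases)
    case 1
    then show ?case using inst by (simp add: house_instance_def)
  next
    case 2
    then show ?case using house_matching_optimal[OF inst] by (elim exE conjE) simp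
  qed
  then show "\<exists>t s. exec house_com (input_state n m v) t s \<and> t \<le> poly (time_poly house_com) (n + m) \<and>
      is_arg_min (total_envy {..<n} v) (is_arg_max (usw {..<n} v) (allocation {..<n} {..<m}))
        (output_allocation n s)"
    by (simp add: wp_def)
qed

end
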